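(* Let $X$ and $Y$ be sets and let $G \le \mathrm{Sym}(X)$ and $H \le \mathrm{Sym}(Y)$ be permutation groups. (a) If $G$ and $H$ are finite then $G \times H$ is join-coherent in its product action on $X \times Y$ if and only if $G$ and $H$ are join-coherent and have coprime orders. (b) If $Y$ is finite then $G \wr H$ is join-coherent in its imprimitive action on $X \times Y$ if and only if $G$ and $H$ are join-coherent.
   Context: For a group $G$ acting on a set $\Omega$ and $g\in G$, $\pi(g)$ denotes the partition of $\Omega$ into the orbits of $g$, and $\pi(G)=\{\pi(g)\mid g\in G\}$. Partitions of $\Omega$ are ordered by refinement ($\mathcal{P}\preccurlyeq\mathcal{Q}$ if every part of $\mathcal{P}$ is contained in a part of $\mathcal{Q}$), and $\mathcal{P}\vee\mathcal{Q}$ denotes the supremum (join) of two partitions. $G$ is join-coherent (in its action on $\Omega$) if $\pi(G)$ is closed under $\vee$. All maps are written on the right. The product action of $G\times H$ on $X\times Y$ is $(x,y)(g,h)=(xg,yh)$. The (unrestricted) wreath product $G\wr H$ is the semidirect product $G^Y\rtimes H$, where $G^Y$ is the group of all maps $Y\to G$ under pointwise multiplication, and $h\in H$ sends $f\in G^Y$ to $h^{-1}\circ f$ (that is, to the map $y\mapsto (yh^{-1})f$). Its imprimitive action on $X\times Y$ is $(x,y)fh=(x(yf),yh)$ for $f\in G^Y$, $h\in H$, $x\in X$, $y\in Y$.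
   Formalization: The sets X and Y are assumed nonempty; if one of them is empty, then X × Y is empty and both products are trivially join-coherent although the group on the other set need not be. *)

theory Defs
  imports "HOL-Algebra.Group_Action" "HOL-Algebra.Product_Groups" "HOL-Algebra.Lattice"
    "HOL-Library.Disjoint_Sets"
begin

section \<open>Symmetric groups with maps written on the right\<close>

text \<open>Maps are written on the right, so the product \<open>f \<otimes> g\<close> means ``first \<open>f\<close>, then \<open>g\<close>''. This is the
  opposite of the group \<^const>\<open>BijGroup\<close>. A right action of \<open>K\<close> on \<open>\<Omega>\<close> is a homomorphism from \<open>K\<close>
  to \<open>Sym \<Omega>\<close>; the point \<open>xg\<close> is written \<open>\<phi> g x\<close>.\<close>

definition Sym :: "'a set \<Rightarrow> ('a \<Rightarrow> 'a) monoid"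
  where "Sym X = \<lparr>carrier = Bij X, monoid.mult = (\<lambda>f g. compose X g f), one = (\<lambda>x\<in>X. x)\<rparr>"

abbreviation perm_group :: "'a set \<Rightarrow> ('a \<Rightarrow> 'a) set \<Rightarrow> ('a \<Rightarrow> 'a) monoid"
  where "perm_group X G \<equiv> Sym X\<lparr>carrier := G\<rparr>"

definition natural_action :: "('a \<Rightarrow> 'a) \<Rightarrow> 'a \<Rightarrow> 'a"
  where "natural_action g = g"

lemma group_Sym: "group (Sym X)"
proof (rule groupI; simp add: Sym_def)
  show "compose X z (compose X y x) = compose X (compose X z y) x"
    if "x \<in> Bij X" "y \<in> Bij X" "z \<in> Bij X" for x y z
    using that by (simp add: compose_assoc Bij_imp_funcset)
  show "\<exists>y\<in>Bij X. compose X x y = (\<lambda>x\<in>X. x)" if "x \<in> Bij X" for x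
    using that restrict_inv_into_Bij[OF that]
    by (intro bexI[of _ "restrict (inv_into X x) X"] ext)
       (auto simp: compose_def Bij_def f_inv_into_f bij_betw_def)
  show "compose X x (\<lambda>x\<in>X. x) = x" if "x \<in> Bij X" for x
    by (rule compose_Id[OF Bij_imp_funcset[OF that] Bij_imp_extensional[OF that]])
qed (auto simp: compose_Bij id_Bij)

lemma group_perm_group: "subgroup G (Sym X) \<Longrightarrow> group (perm_group X G)"
  by (rule subgroup.subgroup_is_group[OF _ group_Sym])

lemma natural_action_hom:
  assumes "subgroup G (Sym X)"
  shows "natural_action \<in> hom (perm_group X G) (Sym X)"
  using subgroup.mem_carrier[OF assms] by (auto simp: hom_def natural_action_def)


section \<open>The order of refinement on partitions\<close>

definition partition_order :: "'a set \<Rightarrow> 'a set set gorder"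
  where "partition_order \<Omega> =
    \<lparr>carrier = {P. partition_on \<Omega> P}, eq = (=), le = refines \<Omega>\<rparr>"

text \<open>Every two partitions have a supremum, so that \<^term>\<open>P \<squnion>\<^bsub>partition_order \<Omega>\<^esub> Q\<close> denotes it.\<close>

lemma partition_order_upper_semilattice: "upper_semilattice (partition_order \<Omega>)"
proof (unfold_locales; (simp add: partition_order_def refines_refl)?)
  show "refines \<Omega> P Q \<Longrightarrow> refines \<Omega> Q P \<Longrightarrow> P = Q" for P Q
    by (rule refines_asym)
  show "refines \<Omega> P Q \<Longrightarrow> refines \<Omega> Q R \<Longrightarrow> refines \<Omega> P R" for P Q R
    by (rule refines_trans)
  fix P Q :: "'a set set"
  assume P: "partition_on \<Omega> P" and Q: "partition_on \<Omega> Q"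
  define r where "r = (\<Union>p\<in>P \<union> Q. p \<times> p)"
  have fld: "r \<subseteq> \<Omega> \<times> \<Omega>"
    using P Q by (auto simp: r_def partition_on_def)
  have "refl_on \<Omega> (r\<^sup>+)"
  proof (rule refl_onI)
    fix x assume "x \<in> \<Omega>"
    then show "(x, x) \<in> r\<^sup>+"
      using P by (auto simp: r_def partition_on_def)
  qed
  moreover have "sym r"
    by (auto simp: r_def sym_def)
  ultimately have eq: "equiv \<Omega> (r\<^sup>+)"
    using trancl_subset_Sigma[OF fld] by (auto intro!: equivI sym_trancl)
  define S where "S = \<Omega> // r\<^sup>+"
  have S: "partition_on \<Omega> S"
    unfolding S_def by (rule partition_on_quotient[OF eq])
  have up: "refines \<Omega> T S" if T: "T = P \<or> T = Q" for T
    unfolding refines_def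
  proof (intro conjI ballI S)
    show pT: "partition_on \<Omega> T"
      using T P Q by auto
    fix p assume p: "p \<in> T"
    then obtain x where x: "x \<in> p" "x \<in> \<Omega>"
      using pT unfolding partition_on_def by (metis Union_iff ex_in_conv)
    have "p \<subseteq> r\<^sup>+ `` {x}"
      using T p x by (auto simp: r_def)
    then show "\<exists>s\<in>S. p \<subseteq> s"
      using x by (auto simp: S_def intro: quotientI)
  qed
  have least: "refines \<Omega> S R" if R: "refines \<Omega> P R" "refines \<Omega> Q R" for R
    unfolding refines_def
  proof (intro conjI ballI S)
    show pR: "partition_on \<Omega> R"
      using R by (simp add: refines_def)
    have step: "z \<in> c" if "c \<in> R" "y \<in> c" "(y, z) \<in> r" for c y z
    proof -
      obtain p where p: "p \<in> P \<union> Q" "y \<in> p" "z \<in> p"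
        using \<open>(y, z) \<in> r\<close> by (auto simp: r_def)
      then obtain d where "d \<in> R" "p \<subseteq> d"
        using R unfolding refines_def by blast
      moreover from this have "d = c"
        using p that pR by (auto simp: partition_on_def dest: disjointD)
      ultimately show ?thesis
        using p by auto
    qed
    fix s assume "s \<in> S"
    then obtain x where x: "x \<in> \<Omega>" "s = r\<^sup>+ `` {x}"
      by (auto simp: S_def quotient_def)
    obtain c where c: "c \<in> R" "x \<in> c"
      using pR x by (auto simp: partition_on_def)
    have "y \<in> c" if "(x, y) \<in> r\<^sup>+" for y
      using that by induction (use c step in auto)
    then show "\<exists>c\<in>R. s \<subseteq> c"
      using x c by auto
  qed
  show "\<exists>s. least \<lparr>carrier = Collect (partition_on \<Omega>), eq = (=), le = refines \<Omega>\<rparr> s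
      (Upper \<lparr>carrier = Collect (partition_on \<Omega>), eq = (=), le = refines \<Omega>\<rparr> {P, Q})"
    using P Q S up least
    by (intro exI[of _ S]) (auto simp: least_def Upper_def)
qed


section \<open>Orbit partitions and join-coherence\<close>

text \<open>\<open>orbit_partition K \<Omega> \<phi> g\<close> is \<open>\<pi>(g)\<close>, the set of orbits on \<open>\<Omega>\<close> of the cyclic
  subgroup generated by \<open>g\<close>. The constant \<^const>\<open>orbits\<close> does not depend on the side of the action.\<close>

definition orbit_partition :: "('g, 'm) monoid_scheme \<Rightarrow> 'a set \<Rightarrow> ('g \<Rightarrow> 'a \<Rightarrow> 'a) \<Rightarrow> 'g \<Rightarrow> 'a set set"
  where "orbit_partition K \<Omega> \<phi> g = orbits (K\<lparr>carrier := generate K {g}\<rparr>) \<Omega> \<phi>"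

definition orbit_partitions :: "('g, 'm) monoid_scheme \<Rightarrow> 'a set \<Rightarrow> ('g \<Rightarrow> 'a \<Rightarrow> 'a) \<Rightarrow> 'a set set set"
  where "orbit_partitions K \<Omega> \<phi> = orbit_partition K \<Omega> \<phi> ` carrier K"

definition join_coherent :: "('g, 'm) monoid_scheme \<Rightarrow> 'a set \<Rightarrow> ('g \<Rightarrow> 'a \<Rightarrow> 'a) \<Rightarrow> bool"
  where "join_coherent K \<Omega> \<phi> \<longleftrightarrow>
    (\<forall>P \<in> orbit_partitions K \<Omega> \<phi>. \<forall>Q \<in> orbit_partitions K \<Omega> \<phi>.
       P \<squnion>\<^bsub>partition_order \<Omega>\<^esub> Q \<in> orbit_partitions K \<Omega> \<phi>)"


section \<open>The product action\<close>

definition product_action ::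
    "'a set \<Rightarrow> 'b set \<Rightarrow> ('a \<Rightarrow> 'a) \<times> ('b \<Rightarrow> 'b) \<Rightarrow> 'a \<times> 'b \<Rightarrow> 'a \<times> 'b"
  where "product_action X Y = (\<lambda>(g, h). \<lambda>(x, y) \<in> X \<times> Y. (g x, h y))"

lemma product_action_hom:
  assumes "subgroup G (Sym X)" "subgroup H (Sym Y)"
  shows "product_action X Y \<in> hom (perm_group X G \<times>\<times> perm_group Y H) (Sym (X \<times> Y))"
proof -
  have G: "g \<in> Bij X" if "g \<in> G" for g
    using subgroup.mem_carrier[OF assms(1) that] by (simp add: Sym_def)
  have H: "h \<in> Bij Y" if "h \<in> H" for h
    using subgroup.mem_carrier[OF assms(2) that] by (simp add: Sym_def)
  have "product_action X Y (g, h) \<in> Bij (X \<times> Y)" if "g \<in> G" "h \<in> H" for g h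
  proof -
    have "product_action X Y (g, h) = restrict (map_prod g h) (X \<times> Y)"
      by (auto simp: product_action_def fun_eq_iff)
    moreover have "bij_betw (map_prod g h) (X \<times> Y) (X \<times> Y)"
      using G[OF that(1)] H[OF that(2)]
      by (simp add: Bij_def bij_betw_map_prod)
    ultimately show ?thesis
      by (simp add: Bij_def)
  qed
  moreover have "product_action X Y (compose X g' g, compose Y h' h) =
      compose (X \<times> Y) (product_action X Y (g', h')) (product_action X Y (g, h))"
    if "g \<in> G" "h \<in> H" for g g' h h'
    using Bij_imp_funcset[OF G[OF that(1)]] Bij_imp_funcset[OF H[OF that(2)]]
    by (auto simp: product_action_def compose_def fun_eq_iff)
  ultimately show ?thesis
    by (auto simp: hom_def Sym_def DirProd_def)
qed


section \<open>The wreath product and its imprimitive action\<close>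

text \<open>The semidirect product \<open>K \<rtimes> H\<close> with respect to a right action \<open>\<theta>\<close> of \<open>H\<close> on \<open>K\<close> by
  automorphisms, with \<open>k\<^sup>h = h\<inverse>kh = \<theta> h k\<close>. The pair \<open>(k, h)\<close> stands for the product \<open>kh\<close>, and
  \<open>(kh)(k'h') = k (h k' h\<inverse>) h h'\<close>, which is where the inverse in the multiplication comes from.\<close>

definition semidirect_product ::
    "('k, 'm) monoid_scheme \<Rightarrow> ('h, 'n) monoid_scheme \<Rightarrow> ('h \<Rightarrow> 'k \<Rightarrow> 'k) \<Rightarrow> ('k \<times> 'h) monoid"
  where "semidirect_product K H \<theta> =
    \<lparr>carrier = carrier K \<times> carrier H,
     monoid.mult = (\<lambda>(k, h) (k', h'). (k \<otimes>\<^bsub>K\<^esub> \<theta> (inv\<^bsub>H\<^esub> h) k', h \<otimes>\<^bsub>H\<^esub> h')),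
     one = (\<one>\<^bsub>K\<^esub>, \<one>\<^bsub>H\<^esub>)\<rparr>"

text \<open>Here \<open>H\<close> is a permutation group on \<open>Y\<close>, and \<open>h\<close> sends \<open>f\<close> to the map \<open>y \<mapsto> (yh\<inverse>)f\<close>.\<close>

definition wreath_product ::
    "('g, 'm) monoid_scheme \<Rightarrow> 'b set \<Rightarrow> ('b \<Rightarrow> 'b, 'n) monoid_scheme \<Rightarrow> (('b \<Rightarrow> 'g) \<times> ('b \<Rightarrow> 'b)) monoid"
  where "wreath_product G Y H =
    semidirect_product (product_group Y (\<lambda>_. G)) H (\<lambda>h f. \<lambda>y\<in>Y. f ((inv\<^bsub>H\<^esub> h) y))"

definition imprimitive_action ::
    "'a set \<Rightarrow> 'b set \<Rightarrow> ('b \<Rightarrow> 'a \<Rightarrow> 'a) \<times> ('b \<Rightarrow> 'b) \<Rightarrow> 'a \<times> 'b \<Rightarrow> 'a \<times> 'b"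
  where "imprimitive_action X Y = (\<lambda>(f, h). \<lambda>(x, y) \<in> X \<times> Y. (f y x, h y))"

lemma wreath_product_mult:
  assumes "subgroup H (Sym Y)" "h \<in> H"
  shows "(f, h) \<otimes>\<^bsub>wreath_product G Y (perm_group Y H)\<^esub> (f', h') =
    (\<lambda>y\<in>Y. f y \<otimes>\<^bsub>G\<^esub> f' (h y), compose Y h' h)"
proof -
  interpret H: group "perm_group Y H"
    by (rule group_perm_group[OF assms(1)])
  have "inv\<^bsub>perm_group Y H\<^esub> (inv\<^bsub>perm_group Y H\<^esub> h) = h"
    using assms(2) by simp
  then show ?thesis
    by (auto simp: wreath_product_def semidirect_product_def Sym_def)
qed

lemma group_wreath_product:
  assumes "group G" "subgroup H (Sym Y)"
  shows "group (wreath_product G Y (perm_group Y H))"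
proof -
  interpret G: group G by (rule assms(1))
  interpret H: group "perm_group Y H" by (rule group_perm_group[OF assms(2)])
  let ?W = "wreath_product G Y (perm_group Y H)"
  have Bij: "h \<in> Bij Y" if "h \<in> H" for h
    using subgroup.mem_carrier[OF assms(2) that] by (simp add: Sym_def)
  have maps: "h y \<in> Y" if "h \<in> H" "y \<in> Y" for h y
    using Bij_imp_funcset[OF Bij[OF that(1)]] that(2) by auto
  have comp: "compose Y h' h \<in> H" if "h \<in> H" "h' \<in> H" for h h'
    using H.m_closed[of h h'] that by (simp add: Sym_def)
  have carr: "carrier ?W = (Y \<rightarrow>\<^sub>E carrier G) \<times> H"
    by (simp add: wreath_product_def semidirect_product_def)
  have one: "\<one>\<^bsub>?W\<^esub> = (\<lambda>y\<in>Y. \<one>\<^bsub>G\<^esub>, \<lambda>y\<in>Y. y)"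
    by (simp add: wreath_product_def semidirect_product_def Sym_def)
  have idH: "(\<lambda>y\<in>Y. y) \<in> H"
    using H.one_closed by (simp add: Sym_def)
  note mult = wreath_product_mult[OF assms(2)]
  show ?thesis
  proof (rule groupI)
    fix a assume "a \<in> carrier ?W"
    then obtain f h where a: "a = (f, h)" and f: "f \<in> Y \<rightarrow>\<^sub>E carrier G" and h: "h \<in> H"
      by (auto simp: carr)
    define k where "k = inv\<^bsub>perm_group Y H\<^esub> h"
    have k: "k \<in> H"
      using H.inv_closed[of h] h by (simp add: k_def)
    have kh: "compose Y h k = (\<lambda>y\<in>Y. y)"
      using H.l_inv[of h] h by (simp add: k_def Sym_def)
    show "\<exists>b\<in>carrier ?W. b \<otimes>\<^bsub>?W\<^esub> a = \<one>\<^bsub>?W\<^esub>"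
    proof
      show "(\<lambda>y\<in>Y. inv\<^bsub>G\<^esub> (f (k y)), k) \<in> carrier ?W"
        using f k maps by (auto simp: carr)
      show "(\<lambda>y\<in>Y. inv\<^bsub>G\<^esub> (f (k y)), k) \<otimes>\<^bsub>?W\<^esub> a = \<one>\<^bsub>?W\<^esub>"
        using kh by (auto simp: a one mult[OF k] fun_eq_iff intro!: G.l_inv PiE_mem[OF f] maps[OF k])
    qed
    show "\<one>\<^bsub>?W\<^esub> \<otimes>\<^bsub>?W\<^esub> a = a"
      using f Bij[OF h]
      by (auto simp: a one mult[OF idH] fun_eq_iff PiE_iff extensional_def compose_def Bij_def)
  next
    fix a b assume "a \<in> carrier ?W" "b \<in> carrier ?W"
    then obtain f h f' h' where ab: "a = (f, h)" "b = (f', h')"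
      and h: "h \<in> H" "h' \<in> H"
      and f: "f \<in> Y \<rightarrow>\<^sub>E carrier G" "f' \<in> Y \<rightarrow>\<^sub>E carrier G"
      by (auto simp: carr)
    have "f y \<otimes>\<^bsub>G\<^esub> f' (h y) \<in> carrier G" if "y \<in> Y" for y
      by (rule G.m_closed[OF PiE_mem[OF f(1) that] PiE_mem[OF f(2) maps[OF h(1) that]]])
    then show "a \<otimes>\<^bsub>?W\<^esub> b \<in> carrier ?W"
      using h by (simp add: carr ab mult comp)
  next
    show "\<one>\<^bsub>?W\<^esub> \<in> carrier ?W"
      by (simp add: carr one idH)
  next
    fix a b c assume "a \<in> carrier ?W" "b \<in> carrier ?W" "c \<in> carrier ?W"
    then obtain f h f' h' f'' h'' where abc: "a = (f, h)" "b = (f', h')" "c = (f'', h'')"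
      and h: "h \<in> H" "h' \<in> H" "h'' \<in> H"
      and f: "f \<in> Y \<rightarrow>\<^sub>E carrier G" "f' \<in> Y \<rightarrow>\<^sub>E carrier G" "f'' \<in> Y \<rightarrow>\<^sub>E carrier G"
      by (auto simp: carr)
    have "f y \<otimes>\<^bsub>G\<^esub> f' (h y) \<otimes>\<^bsub>G\<^esub> f'' (h' (h y)) = f y \<otimes>\<^bsub>G\<^esub> (f' (h y) \<otimes>\<^bsub>G\<^esub> f'' (h' (h y)))"
      if "y \<in> Y" for y
      by (rule G.m_assoc[OF PiE_mem[OF f(1) that] PiE_mem[OF f(2) maps[OF h(1) that]]
            PiE_mem[OF f(3) maps[OF h(2) maps[OF h(1) that]]]])
    then show "a \<otimes>\<^bsub>?W\<^esub> b \<otimes>\<^bsub>?W\<^esub> c = a \<otimes>\<^bsub>?W\<^esub> (b \<otimes>\<^bsub>?W\<^esub> c)"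
      unfolding abc mult[OF h(1)] mult[OF h(2)] mult[OF comp[OF h(1,2)]]
      by (simp add: compose_def fun_eq_iff maps[OF h(1)])
  qed
qed

lemma imprimitive_action_hom:
  assumes "subgroup G (Sym X)" "subgroup H (Sym Y)"
  shows "imprimitive_action X Y \<in>
    hom (wreath_product (perm_group X G) Y (perm_group Y H)) (Sym (X \<times> Y))"
proof -
  have G: "g \<in> Bij X" if "g \<in> G" for g
    using subgroup.mem_carrier[OF assms(1) that] by (simp add: Sym_def)
  have H: "h \<in> Bij Y" if "h \<in> H" for h
    using subgroup.mem_carrier[OF assms(2) that] by (simp add: Sym_def)
  have "imprimitive_action X Y (f, h) \<in> Bij (X \<times> Y)" if f: "f \<in> Y \<rightarrow>\<^sub>E G" and h: "h \<in> H" for f h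
  proof -
    have f: "bij_betw (f y) X X" if "y \<in> Y" for y
      using G f that by (auto simp: Bij_def)
    have h: "bij_betw h Y Y"
      using H h by (auto simp: Bij_def)
    have "inj_on (imprimitive_action X Y (f, h)) (X \<times> Y)"
    proof (rule inj_onI, clarify)
      fix x y x' y'
      assume *: "x \<in> X" "y \<in> Y" "x' \<in> X" "y' \<in> Y"
        "imprimitive_action X Y (f, h) (x, y) = imprimitive_action X Y (f, h) (x', y')"
      then have "y = y'"
        using bij_betw_imp_inj_on[OF h] by (auto simp: imprimitive_action_def dest: inj_onD)
      with * show "x = x' \<and> y = y'"
        using bij_betw_imp_inj_on[OF f] by (auto simp: imprimitive_action_def dest: inj_onD)
    qed
    moreover have "imprimitive_action X Y (f, h) ` (X \<times> Y) = X \<times> Y"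
    proof (intro equalityI subsetI)
      show "p \<in> X \<times> Y" if "p \<in> imprimitive_action X Y (f, h) ` (X \<times> Y)" for p
        using that bij_betwE[OF f] bij_betwE[OF h] by (auto simp: imprimitive_action_def)
      fix p assume "p \<in> X \<times> Y"
      then obtain x y where p: "p = (x, y)" and "x \<in> X" "y \<in> Y"
        by auto
      obtain y' where y': "y' \<in> Y" "h y' = y"
        using \<open>y \<in> Y\<close> bij_betw_imp_surj_on[OF h] by (metis imageE)
      obtain x' where x': "x' \<in> X" "f y' x' = x"
        using \<open>x \<in> X\<close> bij_betw_imp_surj_on[OF f[OF y'(1)]] by (metis imageE)
      show "p \<in> imprimitive_action X Y (f, h) ` (X \<times> Y)"
        using x' y' p by (intro image_eqI[of _ _ "(x', y')"]) (auto simp: imprimitive_action_def)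
    qed
    ultimately show ?thesis
      by (auto simp: Bij_def bij_betw_def imprimitive_action_def)
  qed
  moreover have "imprimitive_action X Y (\<lambda>y\<in>Y. compose X (f' (h y)) (f y), compose Y h' h) =
      compose (X \<times> Y) (imprimitive_action X Y (f', h')) (imprimitive_action X Y (f, h))"
    if f: "f \<in> Y \<rightarrow>\<^sub>E G" and h: "h \<in> H" for f h f' h'
  proof -
    have "f y x \<in> X" if "x \<in> X" "y \<in> Y" for x y
      using Bij_imp_funcset[OF G[OF PiE_mem[OF f that(2)]]] that(1) by auto
    moreover have "h y \<in> Y" if "y \<in> Y" for y
      using Bij_imp_funcset[OF H[OF h]] that by auto
    ultimately show ?thesis
      by (auto simp: imprimitive_action_def compose_def fun_eq_iff)
  qed
  moreover have "carrier (wreath_product (perm_group X G) Y (perm_group Y H)) = (Y \<rightarrow>\<^sub>E G) \<times> H"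
    by (simp add: wreath_product_def semidirect_product_def)
  ultimately show ?thesis
    by (auto simp: hom_def wreath_product_mult[OF assms(2)]) (simp_all add: Sym_def)
qed

end

theory Submission
  imports Defs "HOL-Algebra.Multiplicative_Group" "HOL-Algebra.Sylow" "HOL-Number_Theory.Cong"
begin

text \<open>A partition is determined by its saturated sets, and the sets saturated for a join are those
  saturated for both partitions. Hence \<open>\<pi>(k) = \<pi>(g) \<or> \<pi>(h)\<close> if and only if the \<open>k\<close>-invariant sets are
  exactly those invariant under both \<open>g\<close> and \<open>h\<close>.

  For the product action, coprimality of the orders makes \<open>(g, 1)\<close> and \<open>(1, h)\<close> powers of \<open>(g, h)\<close>, so
  that invariance is tested on the fibres in each direction. If a prime \<open>p\<close> divides both orders, take
  \<open>g\<close> and \<open>h\<close> of order \<open>p\<close>: the join of \<open>(g, 1)\<close> and \<open>(1, h)\<close> has some part of size \<open>p\<^sup>2\<close>, whereas \<open>(k, l)\<close>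
  with \<open>\<pi>(k) = \<pi>(g)\<close> and \<open>\<pi>(l) = \<pi>(h)\<close> has orbits of size at most \<open>p\<close> there.

  For the wreath product, let \<open>\<pi>(k) = \<pi>(h\<^sub>1) \<or> \<pi>(h\<^sub>2)\<close>. On the part of a representative \<open>r\<close>, the two given
  elements move the fibre over \<open>r\<close> to the fibre over any \<open>y\<close> by some \<open>t\<^sub>y \<in> G\<close>. In these coordinates a
  jointly invariant set is the same in all fibres, and invariant under finitely many elements of \<open>G\<close>
  whose partitions have join \<open>\<pi>(s)\<close> for some \<open>s \<in> G\<close>. The required \<open>(f, k)\<close> is the identity in these
  coordinates except for a single factor \<open>s\<close> on the step that closes the cycle at \<open>r\<close>.\<close>

text \<open>The sets need not be contained in \<open>\<Omega>\<close>; what they contain outside \<open>\<Omega>\<close> is irrelevant.\<close>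

definition invs :: "'a set \<Rightarrow> ('a \<Rightarrow> 'a) \<Rightarrow> 'a set set"
  where "invs \<Omega> g = {A. \<forall>x\<in>\<Omega>. g x \<in> A \<longleftrightarrow> x \<in> A}"

text \<open>For a partition of \<open>\<Omega>\<close>, these are the sets whose trace on
  \<open>\<Omega>\<close> is a union of parts.\<close>

definition saturated :: "'a set set \<Rightarrow> 'a set set"
  where "saturated P = {A. \<forall>p\<in>P. p \<subseteq> A \<or> p \<inter> A = {}}"

text \<open>Only nonnegative powers occur, so that cycle lengths can be counted with
  \<open>^^\<close>; for a permutation of finite order this is the whole orbit.\<close>

definition forward_orbit :: "('a \<Rightarrow> 'a) \<Rightarrow> 'a \<Rightarrow> 'a set"
  where "forward_orbit f x = range (\<lambda>n. (f ^^ n) x)"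

lemma invsD: "A \<in> invs \<Omega> g \<Longrightarrow> x \<in> \<Omega> \<Longrightarrow> g x \<in> A \<longleftrightarrow> x \<in> A"
  by (simp add: invs_def)

lemma invsI: "(\<And>x. x \<in> \<Omega> \<Longrightarrow> g x \<in> A \<longleftrightarrow> x \<in> A) \<Longrightarrow> A \<in> invs \<Omega> g"
  by (simp add: invs_def)


section \<open>Partitions and their saturated sets\<close>

text \<open>For the converse, a part \<open>q\<close> of \<open>Q\<close> is itself saturated for
  \<open>Q\<close>, so a part of \<open>P\<close> that meets \<open>q\<close> lies inside
  it.\<close>

lemma refines_iff_saturated:
  assumes "partition_on \<Omega> P" "partition_on \<Omega> Q"
  shows "refines \<Omega> P Q \<longleftrightarrow> saturated Q \<subseteq> saturated P"
proof
  assume PQ: "refines \<Omega> P Q"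
  have "p \<subseteq> A \<or> p \<inter> A = {}" if A: "A \<in> saturated Q" and p: "p \<in> P" for A p
  proof -
    obtain q where q: "q \<in> Q" "p \<subseteq> q"
      using PQ p by (auto simp: refines_def)
    then have "q \<subseteq> A \<or> q \<inter> A = {}"
      using A by (simp add: saturated_def)
    then show ?thesis
      using q(2) by auto
  qed
  then show "saturated Q \<subseteq> saturated P"
    by (auto simp: saturated_def[of P])
next
  assume sub: "saturated Q \<subseteq> saturated P"
  have "\<exists>q\<in>Q. p \<subseteq> q" if p: "p \<in> P" for p
  proof -
    have "p \<noteq> {}" "p \<subseteq> \<Omega>"
      using p assms(1) by (auto simp: partition_on_def)
    then obtain x where x: "x \<in> p" "x \<in> \<Union>Q"
      using partition_onD1[OF assms(2)] by blast
    then obtain q where q: "q \<in> Q" "x \<in> q" by blast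
    have "q' = q \<or> q' \<inter> q = {}" if "q' \<in> Q" for q'
      using disjointD[OF partition_onD2[OF assms(2)] that q(1)] by blast
    then have "q \<in> saturated Q"
      by (auto simp: saturated_def)
    then have "p \<subseteq> q \<or> p \<inter> q = {}"
      using sub p by (auto simp: saturated_def)
    then have "p \<subseteq> q"
      using x(1) q(2) by blast
    then show ?thesis using q by blast
  qed
  then show "refines \<Omega> P Q"
    using assms by (simp add: refines_def)
qed

lemma saturated_eq_iff:
  assumes "partition_on \<Omega> P" "partition_on \<Omega> Q"
  shows "saturated P = saturated Q \<longleftrightarrow> P = Q"
  using assms by (metis order_refl refines_asym refines_iff_saturated)

lemma partition_on_join:
  assumes "partition_on \<Omega> P" "partition_on \<Omega> Q"
  shows "partition_on \<Omega> (P \<squnion>\<^bsub>partition_order \<Omega>\<^esub> Q)"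
proof -
  interpret upper_semilattice "partition_order \<Omega>"
    by (rule partition_order_upper_semilattice)
  show ?thesis
    using join_closed[of P Q] assms by (simp add: partition_order_def)
qed

text \<open>A set saturated for both partitions splits \<open>\<Omega>\<close> into at most two
  blocks. This split is a common upper bound, so it lies above the join.\<close>

lemma saturated_join:
  assumes P: "partition_on \<Omega> P" and Q: "partition_on \<Omega> Q"
  shows "saturated (P \<squnion>\<^bsub>partition_order \<Omega>\<^esub> Q) = saturated P \<inter> saturated Q"
proof -
  interpret upper_semilattice "partition_order \<Omega>"
    by (rule partition_order_upper_semilattice)
  let ?J = "P \<squnion>\<^bsub>partition_order \<Omega>\<^esub> Q"
  have J: "partition_on \<Omega> ?J"
    by (rule partition_on_join[OF P Q])
  have "refines \<Omega> P ?J" "refines \<Omega> Q ?J"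
    using join_left[of P Q] join_right[of P Q] P Q by (auto simp: partition_order_def)
  then have "saturated ?J \<subseteq> saturated P \<inter> saturated Q"
    using refines_iff_saturated P Q J by blast
  moreover have "A \<in> saturated ?J" if A: "A \<in> saturated P" "A \<in> saturated Q" for A
  proof -
    \<comment> \<open>The empty block is removed since \<open>A\<close> may contain or miss all of
      \<open>\<Omega>\<close>.\<close>
    define S where "S = {A \<inter> \<Omega>, \<Omega> - A} - {{}}"
    have S: "partition_on \<Omega> S"
      by (auto simp: S_def partition_on_def disjoint_def)
    have "refines \<Omega> T S" if T: "partition_on \<Omega> T" "A \<in> saturated T" for T
      unfolding refines_def
    proof (intro conjI ballI T S)
      fix p assume p: "p \<in> T"
      then have "p \<noteq> {}" "p \<subseteq> \<Omega>" "p \<subseteq> A \<or> p \<inter> A = {}"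
        using T by (auto simp: partition_on_def saturated_def)
      then show "\<exists>s\<in>S. p \<subseteq> s"
        by (intro bexI[of _ "if p \<subseteq> A then A \<inter> \<Omega> else \<Omega> - A"]) (auto simp: S_def)
    qed
    then have "refines \<Omega> ?J S"
      using join_le[of P S Q] P Q S A by (auto simp: partition_order_def)
    moreover have "A \<in> saturated S"
      by (auto simp: S_def saturated_def)
    ultimately show ?thesis
      using refines_iff_saturated[OF J S] by blast
  qed
  ultimately show ?thesis by blast
qed


section \<open>Right actions\<close>

text \<open>One setting for the natural, the product and the imprimitive action, so that the
  criterion for join-coherence is proved once.\<close>

locale right_action = group K for K (structure) +
  fixes \<Omega> :: "'x set" and \<phi>
  assumes hom: "\<phi> \<in> hom K (Sym \<Omega>)"
begin

lemma bij: "u \<in> carrier K \<Longrightarrow> bij_betw (\<phi> u) \<Omega> \<Omega>"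
  using hom_in_carrier[OF hom, of u] by (simp add: Sym_def Bij_def)

lemma maps: "u \<in> carrier K \<Longrightarrow> x \<in> \<Omega> \<Longrightarrow> \<phi> u x \<in> \<Omega>"
  using bij bij_betwE by blast

lemma act_one: "x \<in> \<Omega> \<Longrightarrow> \<phi> \<one> x = x"
  using hom_one[OF hom is_group group_Sym] by (simp add: Sym_def)

lemma act_mult: "u \<in> carrier K \<Longrightarrow> v \<in> carrier K \<Longrightarrow> x \<in> \<Omega> \<Longrightarrow> \<phi> (u \<otimes> v) x = \<phi> v (\<phi> u x)"
  using hom_mult[OF hom, of u v] by (simp add: Sym_def compose_def)

lemma act_inv: "u \<in> carrier K \<Longrightarrow> x \<in> \<Omega> \<Longrightarrow> \<phi> (inv u) (\<phi> u x) = x"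
  using act_mult[of u "inv u" x] by (simp add: act_one)

lemma act_inv': "u \<in> carrier K \<Longrightarrow> x \<in> \<Omega> \<Longrightarrow> \<phi> u (\<phi> (inv u) x) = x"
  using act_mult[of "inv u" u x] by (simp add: act_one)

lemma act_pow: "u \<in> carrier K \<Longrightarrow> x \<in> \<Omega> \<Longrightarrow> \<phi> (u [^] (n::nat)) x = (\<phi> u ^^ n) x"
  by (induction n) (auto simp: act_one act_mult)

lemma invs_mult:
  assumes "u \<in> carrier K" "v \<in> carrier K" "A \<in> invs \<Omega> (\<phi> u)" "A \<in> invs \<Omega> (\<phi> v)"
  shows "A \<in> invs \<Omega> (\<phi> (u \<otimes> v))"
  using assms by (simp add: invs_def act_mult maps)

lemma invs_one: "invs \<Omega> (\<phi> \<one>) = UNIV"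
  by (simp add: invs_def act_one)

lemma invs_inv:
  assumes "u \<in> carrier K" "A \<in> invs \<Omega> (\<phi> u)"
  shows "A \<in> invs \<Omega> (\<phi> (inv u))"
proof (rule invsI)
  fix x assume x: "x \<in> \<Omega>"
  show "\<phi> (inv u) x \<in> A \<longleftrightarrow> x \<in> A"
    using invsD[OF assms(2) maps[OF inv_closed[OF assms(1)] x]] act_inv'[OF assms(1) x] by simp
qed

lemma invs_pow:
  assumes "u \<in> carrier K" "A \<in> invs \<Omega> (\<phi> u)"
  shows "A \<in> invs \<Omega> (\<phi> (u [^] (n::nat)))"
  using assms by (induction n) (auto simp: invs_one invs_mult)

lemma invs_generate:
  assumes "u \<in> carrier K" "A \<in> invs \<Omega> (\<phi> u)" "v \<in> generate K {u}"
  shows "A \<in> invs \<Omega> (\<phi> v)"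
  using assms(3)
proof induction
  case (eng v w)
  then show ?case
    using assms(1) by (intro invs_mult generate_in_carrier[of "{u}"]) auto
qed (use assms invs_one invs_inv in auto)

lemma orbit_partition_eq:
  "orbit_partition K \<Omega> \<phi> u = (\<lambda>x. (\<lambda>v. \<phi> v x) ` generate K {u}) ` \<Omega>"
  by (auto simp: orbit_partition_def orbits_def orbit_def image_def)

text \<open>The products \<open>v \<otimes> w\<close> and \<open>inv v \<otimes> w\<close> give the
  two inclusions. Hence two orbits with a common point coincide, which yields the disjointness in
  the orbit partition.\<close>

lemma act_generate_image:
  assumes u: "u \<in> carrier K" and x: "x \<in> \<Omega>" and v: "v \<in> generate K {u}"
  shows "(\<lambda>w. \<phi> w (\<phi> v x)) ` generate K {u} = (\<lambda>w. \<phi> w x) ` generate K {u}"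
proof -
  have car: "w \<in> carrier K" if "w \<in> generate K {u}" for w
    using u that generate_in_carrier[of "{u}"] by simp
  show ?thesis
  proof (intro equalityI image_subsetI)
    fix w assume w: "w \<in> generate K {u}"
    have "\<phi> w (\<phi> v x) = \<phi> (v \<otimes> w) x"
      using act_mult[OF car[OF v] car[OF w] x] by simp
    then show "\<phi> w (\<phi> v x) \<in> (\<lambda>w. \<phi> w x) ` generate K {u}"
      using generate.eng[OF v w] by simp
    have i: "inv v \<in> generate K {u}"
      using generate_m_inv_closed[of "{u}" v] u v by simp
    have "\<phi> w x = \<phi> (inv v \<otimes> w) (\<phi> v x)"
      using act_mult[OF car[OF i] car[OF w] maps[OF car[OF v] x]] act_inv[OF car[OF v] x] by simp
    then show "\<phi> w x \<in> (\<lambda>w. \<phi> w (\<phi> v x)) ` generate K {u}"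
      using generate.eng[OF i w] by simp
  qed
qed

lemma act_generate_self: "x \<in> \<Omega> \<Longrightarrow> x \<in> (\<lambda>v. \<phi> v x) ` generate K {u}"
  by (rule image_eqI[of _ _ \<one>]) (simp_all only: act_one generate.one)

lemma partition_on_orbit_partition:
  assumes u: "u \<in> carrier K"
  shows "partition_on \<Omega> (orbit_partition K \<Omega> \<phi> u)"
  unfolding orbit_partition_eq
proof (rule partition_onI)
  let ?o = "\<lambda>x. (\<lambda>v. \<phi> v x) ` generate K {u}"
  have sub: "?o x \<subseteq> \<Omega>" if "x \<in> \<Omega>" for x
    using that maps u generate_in_carrier[of "{u}"] by (simp add: image_subset_iff)
  show "\<Union> (?o ` \<Omega>) = \<Omega>"
  proof (intro equalityI subsetI)
    show "x \<in> \<Omega>" if "x \<in> \<Union> (?o ` \<Omega>)" for x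
      using that sub by fast
    show "x \<in> \<Union> (?o ` \<Omega>)" if "x \<in> \<Omega>" for x
      by (rule UN_I[of x], rule that, rule act_generate_self[OF that])
  qed
  show "{} \<notin> ?o ` \<Omega>"
    using generate.one[of K "{u}"] by auto
  fix p q assume "p \<in> ?o ` \<Omega>" "q \<in> ?o ` \<Omega>" "p \<noteq> q"
  then obtain x y where xy: "x \<in> \<Omega>" "p = ?o x" "y \<in> \<Omega>" "q = ?o y" by blast
  have False if z: "z \<in> p" "z \<in> q" for z
  proof -
    obtain v w where v: "v \<in> generate K {u}" "z = \<phi> v x" and w: "w \<in> generate K {u}" "z = \<phi> w y"
      using z xy by blast
    have "?o z = p" "?o z = q"
      unfolding xy(2,4) v(2) unfolding v(2)[symmetric] w(2)
      using act_generate_image[OF u xy(1) v(1)] act_generate_image[OF u xy(3) w(1)] v(2) w(2) by simp_all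
    then show False
      using \<open>p \<noteq> q\<close> by simp
  qed
  then show "disjnt p q"
    unfolding disjnt_iff by blast
qed

text \<open>Invariance under \<open>u\<close> passes to inverses and products, hence to the cyclic
  group generated by \<open>u\<close>; conversely, \<open>x\<close> and its image under
  \<open>u\<close> share an orbit.\<close>

lemma saturated_orbit_partition:
  assumes u: "u \<in> carrier K"
  shows "saturated (orbit_partition K \<Omega> \<phi> u) = invs \<Omega> (\<phi> u)"
proof (intro equalityI subsetI)
  fix A assume A: "A \<in> invs \<Omega> (\<phi> u)"
  have "\<phi> v x \<in> A \<longleftrightarrow> x \<in> A" if "v \<in> generate K {u}" "x \<in> \<Omega>" for v x
    using invs_generate[OF u A that(1)] that(2) by (rule invsD)
  then show "A \<in> saturated (orbit_partition K \<Omega> \<phi> u)"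
    unfolding saturated_def orbit_partition_eq by auto
next
  fix A assume A: "A \<in> saturated (orbit_partition K \<Omega> \<phi> u)"
  show "A \<in> invs \<Omega> (\<phi> u)"
  proof (rule invsI)
    fix x assume x: "x \<in> \<Omega>"
    let ?o = "(\<lambda>v. \<phi> v x) ` generate K {u}"
    have "?o \<subseteq> A \<or> ?o \<inter> A = {}"
      using A x by (simp add: saturated_def orbit_partition_eq)
    moreover have "x \<in> ?o"
      by (rule act_generate_self[OF x])
    moreover have "\<phi> u x \<in> ?o"
      by (rule imageI) (simp add: generate.incl)
    ultimately show "\<phi> u x \<in> A \<longleftrightarrow> x \<in> A"
      by blast
  qed
qed

text \<open>Partitions are equal when their saturated sets are, and those of a join form an
  intersection. From here on, only invariant sets are compared.\<close>

lemma join_coherent_iff: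
  "join_coherent K \<Omega> \<phi> \<longleftrightarrow>
    (\<forall>u\<in>carrier K. \<forall>v\<in>carrier K. \<exists>w\<in>carrier K. invs \<Omega> (\<phi> w) = invs \<Omega> (\<phi> u) \<inter> invs \<Omega> (\<phi> v))"
proof -
  let ?\<pi> = "orbit_partition K \<Omega> \<phi>"
  have "?\<pi> u \<squnion>\<^bsub>partition_order \<Omega>\<^esub> ?\<pi> v = ?\<pi> w \<longleftrightarrow>
      invs \<Omega> (\<phi> w) = invs \<Omega> (\<phi> u) \<inter> invs \<Omega> (\<phi> v)"
    if "u \<in> carrier K" "v \<in> carrier K" "w \<in> carrier K" for u v w
    using that saturated_join[of \<Omega> "?\<pi> u" "?\<pi> v"]
      saturated_eq_iff[of \<Omega> "?\<pi> u \<squnion>\<^bsub>partition_order \<Omega>\<^esub> ?\<pi> v" "?\<pi> w"]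
    by (auto simp: partition_on_orbit_partition partition_on_join saturated_orbit_partition)
  then show ?thesis
    unfolding join_coherent_def orbit_partitions_def by (simp add: image_iff)
qed

section \<open>Forward orbits of a group element\<close>

lemma forward_orbit_subset:
  assumes "u \<in> carrier K" "x \<in> \<Omega>" "A \<in> invs \<Omega> (\<phi> u)" "x \<in> A"
  shows "forward_orbit (\<phi> u) x \<subseteq> A"
  unfolding forward_orbit_def
  using invsD[OF invs_pow[OF assms(1,3)] assms(2)] assms by (auto simp: act_pow)

lemma forward_orbit_invs:
  assumes "finite (carrier K)" "u \<in> carrier K" "x \<in> \<Omega>"
  shows "forward_orbit (\<phi> u) x \<in> invs \<Omega> (\<phi> u)"
proof (rule invsI)
  fix z assume z: "z \<in> \<Omega>"
  have pos: "order K > 0"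
    using assms(1) order_gt_0_iff_finite by blast
  show "\<phi> u z \<in> forward_orbit (\<phi> u) x \<longleftrightarrow> z \<in> forward_orbit (\<phi> u) x"
  proof
    assume "\<phi> u z \<in> forward_orbit (\<phi> u) x"
    then obtain n where n: "\<phi> u z = (\<phi> u ^^ n) x"
      by (auto simp: forward_orbit_def)
    have "(\<phi> u ^^ order K) z = z"
      using act_pow[OF assms(2) z, of "order K"] by (simp add: pow_order_eq_1 assms z act_one)
    \<comment> \<open>Finite order turns the backward step into forward ones: the power
      \<open>order K - 1\<close> takes \<open>\<phi> u z\<close> back to \<open>z\<close>.\<close>
    then have "z = (\<phi> u ^^ (order K - 1)) (\<phi> u z)"
      using pos by (metis Suc_diff_1 comp_apply funpow_Suc_right)
    then have "z = (\<phi> u ^^ (order K - 1 + n)) x"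
      by (simp add: n funpow_add)
    then show "z \<in> forward_orbit (\<phi> u) x"
      by (auto simp: forward_orbit_def)
  next
    assume "z \<in> forward_orbit (\<phi> u) x"
    then obtain n where "z = (\<phi> u ^^ n) x"
      by (auto simp: forward_orbit_def)
    then have "\<phi> u z = (\<phi> u ^^ Suc n) x"
      by simp
    then show "\<phi> u z \<in> forward_orbit (\<phi> u) x"
      unfolding forward_orbit_def by blast
  qed
qed

end

section \<open>The three actions, and join-coherence in terms of invariant sets\<close>

lemma right_action_natural:
  "subgroup G (Sym X) \<Longrightarrow> right_action (perm_group X G) X natural_action"
  by (simp add: right_action_def right_action_axioms_def group_perm_group natural_action_hom)

lemma right_action_product:
  "subgroup G (Sym X) \<Longrightarrow> subgroup H (Sym Y) \<Longrightarrow>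
    right_action (perm_group X G \<times>\<times> perm_group Y H) (X \<times> Y) (product_action X Y)"
  by (simp add: right_action_def right_action_axioms_def group_perm_group DirProd_group product_action_hom)

lemma right_action_imprimitive:
  "subgroup G (Sym X) \<Longrightarrow> subgroup H (Sym Y) \<Longrightarrow>
    right_action (wreath_product (perm_group X G) Y (perm_group Y H)) (X \<times> Y) (imprimitive_action X Y)"
  by (simp add: right_action_def right_action_axioms_def group_perm_group group_wreath_product
      imprimitive_action_hom)

lemma carrier_wreath_product:
  "carrier (wreath_product (perm_group X G) Y (perm_group Y H)) = (Y \<rightarrow>\<^sub>E G) \<times> H"
  by (simp add: wreath_product_def semidirect_product_def)

lemma join_coherent_natural_iff:
  assumes "subgroup G (Sym X)"
  shows "join_coherent (perm_group X G) X natural_action \<longleftrightarrow>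
    (\<forall>g\<in>G. \<forall>h\<in>G. \<exists>k\<in>G. invs X k = invs X g \<inter> invs X h)"
  using right_action.join_coherent_iff[OF right_action_natural[OF assms]]
  by (simp add: natural_action_def)

lemma join_coherent_product_iff:
  assumes "subgroup G (Sym X)" "subgroup H (Sym Y)"
  shows "join_coherent (perm_group X G \<times>\<times> perm_group Y H) (X \<times> Y) (product_action X Y) \<longleftrightarrow>
    (\<forall>u\<in>G \<times> H. \<forall>v\<in>G \<times> H. \<exists>w\<in>G \<times> H. invs (X \<times> Y) (product_action X Y w) =
      invs (X \<times> Y) (product_action X Y u) \<inter> invs (X \<times> Y) (product_action X Y v))"
  using right_action.join_coherent_iff[OF right_action_product[OF assms]] by simp

lemma join_coherent_imprimitive_iff:
  assumes "subgroup G (Sym X)" "subgroup H (Sym Y)"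
  shows "join_coherent (wreath_product (perm_group X G) Y (perm_group Y H)) (X \<times> Y)
      (imprimitive_action X Y) \<longleftrightarrow>
    (\<forall>u\<in>(Y \<rightarrow>\<^sub>E G) \<times> H. \<forall>v\<in>(Y \<rightarrow>\<^sub>E G) \<times> H. \<exists>w\<in>(Y \<rightarrow>\<^sub>E G) \<times> H.
      invs (X \<times> Y) (imprimitive_action X Y w) =
      invs (X \<times> Y) (imprimitive_action X Y u) \<inter> invs (X \<times> Y) (imprimitive_action X Y v))"
  using right_action.join_coherent_iff[OF right_action_imprimitive[OF assms]]
  by (simp only: carrier_wreath_product)

lemma mem_invs_product_iff:
  "A \<in> invs (X \<times> Y) (product_action X Y (g, h)) \<longleftrightarrow>
    (\<forall>x\<in>X. \<forall>y\<in>Y. (g x, h y) \<in> A \<longleftrightarrow> (x, y) \<in> A)"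
  by (auto simp: invs_def product_action_def)

lemma mem_invs_imprimitive_iff:
  "A \<in> invs (X \<times> Y) (imprimitive_action X Y (f, h)) \<longleftrightarrow>
    (\<forall>x\<in>X. \<forall>y\<in>Y. (f y x, h y) \<in> A \<longleftrightarrow> (x, y) \<in> A)"
  by (auto simp: invs_def imprimitive_action_def)


section \<open>Permutation groups\<close>

locale permutation_group =
  fixes X :: "'a set" and G :: "('a \<Rightarrow> 'a) set"
  assumes subgroup: "subgroup G (Sym X)"
begin

sublocale right_action "perm_group X G" X natural_action
  by (rule right_action_natural[OF subgroup])

lemma perm_maps: "g \<in> G \<Longrightarrow> x \<in> X \<Longrightarrow> g x \<in> X"
  using maps[of g x] by (simp add: natural_action_def)

lemma perm_bij: "g \<in> G \<Longrightarrow> bij_betw g X X"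
  using bij[of g] by (simp add: natural_action_def)

lemma perm_id: "(\<lambda>x\<in>X. x) \<in> G"
  using one_closed by (simp add: Sym_def)

lemma perm_compose: "g \<in> G \<Longrightarrow> h \<in> G \<Longrightarrow> compose X g h \<in> G"
  using m_closed[of h g] by (simp add: Sym_def)

lemma perm_inverse:
  assumes "g \<in> G"
  obtains g' where "g' \<in> G" "\<And>x. x \<in> X \<Longrightarrow> g' (g x) = x" "\<And>x. x \<in> X \<Longrightarrow> g (g' x) = x"
  using act_inv[of g] act_inv'[of g] inv_closed[of g] assms
  by (auto simp: natural_action_def)

lemma perm_ext: "g \<in> G \<Longrightarrow> g \<in> extensional X"
  using subgroup.mem_carrier[OF subgroup] by (auto simp: Sym_def Bij_def)

lemma invs_id: "invs X (\<lambda>x\<in>X. x) = UNIV"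
  by (simp add: invs_def)

text \<open>Binary joins are iterated; the empty family is realised by the identity, under which
  every set is invariant.\<close>

lemma join_finite:
  assumes "\<forall>g\<in>G. \<forall>h\<in>G. \<exists>k\<in>G. invs X k = invs X g \<inter> invs X h"
    and "finite F" "F \<subseteq> G"
  shows "\<exists>s\<in>G. invs X s = {A. \<forall>g\<in>F. A \<in> invs X g}"
  using assms(2,3)
proof induction
  case empty
  then show ?case
    using perm_id invs_id by auto
next
  case (insert g F)
  then obtain s where s: "s \<in> G" "invs X s = {A. \<forall>g\<in>F. A \<in> invs X g}" by auto
  obtain k where "k \<in> G" "invs X k = invs X g \<inter> invs X s"
    using assms(1) insert.prems s(1) by (meson insert_subset)
  then show ?case
    using s by (intro bexI[of _ k]) auto
qed

end

lemma (in permutation_group) forward_orbit_subset_perm: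
  assumes "g \<in> G" "x \<in> X" "A \<in> invs X g" "x \<in> A"
  shows "forward_orbit g x \<subseteq> A"
  using forward_orbit_subset[of g x A] assms by (simp add: natural_action_def)

lemma (in permutation_group) forward_orbit_invs_perm:
  assumes "finite G" "g \<in> G" "x \<in> X"
  shows "forward_orbit g x \<in> invs X g"
  using forward_orbit_invs[of g x] assms by (simp add: natural_action_def)

lemma (in permutation_group) perm_pow: "g \<in> G \<Longrightarrow> x \<in> X \<Longrightarrow> (g [^]\<^bsub>perm_group X G\<^esub> (n::nat)) x = (g ^^ n) x"
  using act_pow[of g x n] by (simp add: natural_action_def)

lemma (in permutation_group) perm_one: "x \<in> X \<Longrightarrow> \<one>\<^bsub>perm_group X G\<^esub> x = x"
  using act_one[of x] by (simp add: natural_action_def)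

lemma self_in_forward_orbit: "x \<in> forward_orbit f x"
  unfolding forward_orbit_def by (rule range_eqI[of _ _ 0]) simp


section \<open>The product action\<close>

lemma funpow_mult_fixed: "(f ^^ d) x = x \<Longrightarrow> (f ^^ (d * m)) x = x"
  by (induction m) (auto simp: funpow_add)

text \<open>An \<open>n\<close> prime to \<open>p\<close> has an inverse \<open>a\<close> modulo
  \<open>p\<close>. If the power \<open>n\<close> fixed \<open>x\<close>, so would the power
  \<open>n * a\<close>, which acts on \<open>x\<close> as \<open>f\<close>.\<close>

lemma funpow_prime_fixed_iff:
  assumes "prime p" "(f ^^ p) x = x" "f x \<noteq> x"
  shows "(f ^^ n) x = x \<longleftrightarrow> p dvd n"
proof
  assume n: "(f ^^ n) x = x"
  show "p dvd n"
  proof (rule ccontr)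
    assume "\<not> p dvd n"
    then have "coprime n p"
      using prime_imp_coprime[OF assms(1)] by (simp add: coprime_commute)
    then obtain a where a: "[n * a = Suc 0] (mod p)"
      using cong_solve_coprime_nat by blast
    have "(f ^^ (n * a)) x = (f ^^ ((n * a) mod p)) x"
      by (rule funpow_mod_eq[OF assms(2), symmetric])
    also have "\<dots> = f x"
      using a prime_gt_1_nat[OF assms(1)] by (simp add: cong_def)
    finally show False
      using funpow_mult_fixed[OF n, of a] assms(3) by simp
  qed
next
  assume "p dvd n"
  then show "(f ^^ n) x = x"
    using funpow_mult_fixed[OF assms(2)] by (auto simp: dvd_def)
qed

lemma card_forward_orbit:
  assumes "(f ^^ d) x = x" "d > 0" "\<And>n. 0 < n \<Longrightarrow> n < d \<Longrightarrow> (f ^^ n) x \<noteq> x"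
  shows "card (forward_orbit f x) = d"
proof -
  have "forward_orbit f x = (\<lambda>n. (f ^^ n) x) ` {..<d}"
    unfolding forward_orbit_def
  proof (intro equalityI image_subsetI)
    fix n show "(f ^^ n) x \<in> (\<lambda>n. (f ^^ n) x) ` {..<d}"
      using assms(2) funpow_mod_eq[OF assms(1), of n] by (intro image_eqI[of _ _ "n mod d"]) auto
  qed auto
  moreover have "(f ^^ i) x \<noteq> (f ^^ j) x" if "i < j" "j < d" for i j
  proof
    assume "(f ^^ i) x = (f ^^ j) x"
    \<comment> \<open>Completing the cycle from \<open>j\<close> shows that
      \<open>d - j + i\<close>, which is positive and less than \<open>d\<close>, would be a
      period.\<close>
    then have "(f ^^ (d - j)) ((f ^^ i) x) = (f ^^ (d - j)) ((f ^^ j) x)" by simp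
    then have "(f ^^ (d - j + i)) x = (f ^^ (d - j + j)) x"
      by (simp only: funpow_add comp_apply)
    moreover have "0 < d - j + i" "d - j + i < d" "d - j + j = d"
      using that by linarith+
    ultimately show False
      using assms(3)[of "d - j + i"] assms(1) by simp
  qed
  then have "inj_on (\<lambda>n. (f ^^ n) x) {..<d}"
    unfolding inj_on_def by (metis lessThan_iff linorder_neqE_nat)
  ultimately show ?thesis
    by (simp add: card_image)
qed

text \<open>The least positive period equals the size of the orbit, so a period can be read off from
  the orbit as a mere set.\<close>

lemma funpow_card_forward_orbit:
  assumes "(f ^^ d) x = x" "d > 0"
  shows "(f ^^ card (forward_orbit f x)) x = x"
proof -
  define e where "e = (LEAST n. 0 < n \<and> (f ^^ n) x = x)"
  have e: "0 < e \<and> (f ^^ e) x = x"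
    unfolding e_def by (rule LeastI[of _ d]) (use assms in simp)
  have "(f ^^ n) x \<noteq> x" if "0 < n" "n < e" for n
    using not_less_Least[of n "\<lambda>n. 0 < n \<and> (f ^^ n) x = x"] that by (simp add: e_def)
  then show ?thesis
    using card_forward_orbit[of e f x] e by simp
qed

context permutation_group
begin

lemma perm_funpow_order:
  assumes "finite G" "g \<in> G" "x \<in> X"
  shows "(g ^^ order (perm_group X G)) x = x"
  using pow_order_eq_1[of g] perm_pow[of g x "order (perm_group X G)"] assms perm_one[of x] by simp

text \<open>Each forward orbit is the least invariant set containing \<open>x\<close>, up to points
  outside \<open>X\<close>, and \<open>k\<close> and \<open>g\<close> have the same invariant
  sets.\<close>

lemma forward_orbit_eq_if_invs_eq:
  assumes "finite G" "g \<in> G" "k \<in> G" "x \<in> X" "invs X k = invs X g"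
  shows "forward_orbit k x = forward_orbit g x"
proof
  show "forward_orbit k x \<subseteq> forward_orbit g x"
    using forward_orbit_invs_perm[of g x] assms by (intro forward_orbit_subset_perm self_in_forward_orbit) auto
  show "forward_orbit g x \<subseteq> forward_orbit k x"
    using forward_orbit_invs_perm[of k x] assms by (intro forward_orbit_subset_perm self_in_forward_orbit) auto
qed

text \<open>The orbit of \<open>x\<close> under \<open>g\<close> has size \<open>p\<close>, and it
  is also the orbit under \<open>k\<close>; so \<open>x\<close> lies in a cycle of \<open>k\<close>
  of length \<open>p\<close>.\<close>

lemma funpow_prime_fixed_iff_invs_eq:
  assumes "finite G" "g \<in> G" "k \<in> G" "x \<in> X" "invs X k = invs X g"
    and "prime p" "(g ^^ p) x = x" "g x \<noteq> x"
  shows "(k ^^ n) x = x \<longleftrightarrow> p dvd n"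
proof (rule funpow_prime_fixed_iff[OF assms(6)])
  have "card (forward_orbit g x) = p"
    using prime_gt_0_nat[OF assms(6)] funpow_prime_fixed_iff[OF assms(6-8)] assms(7)
    by (intro card_forward_orbit) (auto dest: nat_dvd_not_less)
  moreover have "order (perm_group X G) > 0"
    using assms(1) order_gt_0_iff_finite by simp
  ultimately show "(k ^^ p) x = x"
    using funpow_card_forward_orbit[OF perm_funpow_order[OF assms(1,3,4)]]
      forward_orbit_eq_if_invs_eq[OF assms(1-5)] by simp
  show "k x \<noteq> x"
  proof
    assume *: "k x = x"
    have "(k ^^ n) x = x" for n
      by (induction n) (auto simp: *)
    then have "forward_orbit k x = {x}"
      by (auto simp: forward_orbit_def)
    moreover have "(g ^^ 1) x \<in> forward_orbit g x"
      unfolding forward_orbit_def by blast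
    ultimately show False
      using forward_orbit_eq_if_invs_eq[OF assms(1-5)] assms(8) by simp
  qed
qed

text \<open>Sylow's theorem with exponent 1 supplies a subgroup of order \<open>p\<close>. A
  nonidentity element of it moves a point because members of \<open>Sym X\<close> are determined by
  their values on \<open>X\<close>.\<close>

lemma prime_order_moved_point:
  assumes "finite G" "prime p" "p dvd order (perm_group X G)"
  obtains g x where "g \<in> G" "x \<in> X" "g x \<noteq> x" "\<And>y. y \<in> X \<Longrightarrow> (g ^^ p) y = y"
proof -
  obtain m where "order (perm_group X G) = p ^ 1 * m"
    using assms(3) by auto
  then obtain P where P: "subgroup P (perm_group X G)" "card P = p"
    using sylow_thm[OF assms(2) is_group] assms(1) by fastforce
  then have "P \<noteq> {\<one>\<^bsub>perm_group X G\<^esub>}"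
    using prime_gt_1_nat[OF assms(2)] by auto
  then obtain g where g: "g \<in> P" "g \<noteq> \<one>\<^bsub>perm_group X G\<^esub>"
    using subgroup.one_closed[OF P(1)] by blast
  have gG: "g \<in> G"
    using subgroup.subset[OF P(1)] g(1) by auto
  interpret P: group "perm_group X G\<lparr>carrier := P\<rparr>"
    by (rule subgroup.subgroup_is_group[OF P(1) is_group])
  have "g [^]\<^bsub>perm_group X G\<lparr>carrier := P\<rparr>\<^esub> p = \<one>\<^bsub>perm_group X G\<^esub>"
    using P.pow_order_eq_1[of g] g(1) P(2) by (simp add: order_def)
  then have "g [^]\<^bsub>perm_group X G\<^esub> p = \<one>\<^bsub>perm_group X G\<^esub>"
    by (simp add: nat_pow_def)
  then have "(g ^^ p) y = y" if "y \<in> X" for y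
    using perm_pow[OF gG that, of p] perm_one[OF that] by simp
  moreover have "\<exists>x\<in>X. g x \<noteq> x"
  proof (rule ccontr)
    assume "\<not> ?thesis"
    then have "g = (\<lambda>x\<in>X. x)"
      using perm_ext[OF gG] by (intro extensionalityI) auto
    then show False
      using g(2) by (simp add: Sym_def)
  qed
  ultimately show ?thesis
    using that gG by blast
qed

end

locale two_permutation_groups =
  G: permutation_group X G + H: permutation_group Y H
  for X :: "'a set" and G and Y :: "'b set" and H
begin

text \<open>Membership is carried along because \<open>product_action\<close> is restricted to
  \<open>X \<times> Y\<close>.\<close>

lemma funpow_product_action:
  assumes "g \<in> G" "h \<in> H" "x \<in> X" "y \<in> Y"
  shows "(product_action X Y (g, h) ^^ n) (x, y) = ((g ^^ n) x, (h ^^ n) y)"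
    and "(g ^^ n) x \<in> X \<and> (h ^^ n) y \<in> Y"
  by (induction n) (use assms G.perm_maps H.perm_maps in \<open>auto simp: product_action_def\<close>)

lemma invs_product_left_iff:
  "A \<in> invs (X \<times> Y) (product_action X Y (g, \<lambda>y\<in>Y. y)) \<longleftrightarrow> (\<forall>y\<in>Y. {x. (x, y) \<in> A} \<in> invs X g)"
  unfolding mem_invs_product_iff by (auto simp: invs_def)

lemma invs_product_right_iff:
  "A \<in> invs (X \<times> Y) (product_action X Y (\<lambda>x\<in>X. x, h)) \<longleftrightarrow> (\<forall>x\<in>X. {y. (x, y) \<in> A} \<in> invs Y h)"
  unfolding mem_invs_product_iff by (auto simp: invs_def)

text \<open>Cylinders see only the first component of a pair, which makes its partition recoverable
  from the invariant sets of the pair. A point of \<open>Y\<close> serves to read off the condition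
  on \<open>A\<close>.\<close>

lemma cylinder_left_iff:
  assumes "Y \<noteq> {}" "h \<in> H"
  shows "A \<times> UNIV \<in> invs (X \<times> Y) (product_action X Y (g, h)) \<longleftrightarrow> A \<in> invs X g"
  unfolding mem_invs_product_iff using assms by (auto simp: invs_def)

lemma cylinder_right_iff:
  assumes "X \<noteq> {}" "g \<in> G"
  shows "UNIV \<times> A \<in> invs (X \<times> Y) (product_action X Y (g, h)) \<longleftrightarrow> A \<in> invs Y h"
  unfolding mem_invs_product_iff using assms by (auto simp: invs_def)

lemma invs_product_coprime:
  assumes "finite G" "finite H" "coprime (order (perm_group X G)) (order (perm_group Y H))"
    and "g \<in> G" "h \<in> H"
  shows "invs (X \<times> Y) (product_action X Y (g, h)) =
    invs (X \<times> Y) (product_action X Y (g, \<lambda>y\<in>Y. y)) \<inter> invs (X \<times> Y) (product_action X Y (\<lambda>x\<in>X. x, h))"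
    (is "?I = ?L \<inter> ?R")
proof (intro equalityI subsetI IntI)
  interpret GH: right_action "perm_group X G \<times>\<times> perm_group Y H" "X \<times> Y" "product_action X Y"
    by (rule right_action_product[OF G.subgroup H.subgroup])
  let ?m = "order (perm_group X G)" and ?n = "order (perm_group Y H)"
  fix A
  show "A \<in> ?I" if "A \<in> ?L \<inter> ?R"
    using that assms(4,5) G.perm_maps H.perm_maps by (simp add: mem_invs_product_iff)
  assume A: "A \<in> ?I"
  have A': "((g ^^ k) x, (h ^^ k) y) \<in> A \<longleftrightarrow> (x, y) \<in> A" if "x \<in> X" "y \<in> Y" for x y k
    using invsD[OF GH.invs_pow[OF _ A, of k], of "(x, y)"] GH.act_pow[of "(g, h)" "(x, y)" k]
      that assms(4,5) by (simp add: funpow_product_action)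
  have pos: "?m > 0" "?n > 0"
    using assms(1,2) G.order_gt_0_iff_finite H.order_gt_0_iff_finite by auto
  have red: "(g ^^ k) x = (g ^^ (k mod ?m)) x" "(h ^^ k) y = (h ^^ (k mod ?n)) y"
    if "x \<in> X" "y \<in> Y" for x y k
    using funpow_mod_eq[OF G.perm_funpow_order[OF assms(1,4) that(1)], of k]
      funpow_mod_eq[OF H.perm_funpow_order[OF assms(2,5) that(2)], of k] by simp_all
  \<comment> \<open>The exponent \<open>a\<close> turns \<open>(g, h)\<close> into
    \<open>(g, 1)\<close>, and \<open>b\<close> below turns it into \<open>(1, h)\<close>.\<close>
  obtain a where a: "[a = 1] (mod ?m)" "[a = 0] (mod ?n)"
    using binary_chinese_remainder_nat[OF assms(3)] by blast
  obtain b where b: "[b = 0] (mod ?m)" "[b = 1] (mod ?n)"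
    using binary_chinese_remainder_nat[OF assms(3)] by blast
  \<comment> \<open>If an order is 1, the exponent is 0; the group is then trivial, and the equation
    still holds.\<close>
  have *: "(g ^^ (1 mod ?m)) x = g x" "(h ^^ (1 mod ?n)) y = h y" if "x \<in> X" "y \<in> Y" for x y
    using red[OF that, of 1] by simp_all
  have "(g ^^ a) x = g x" "(h ^^ a) y = y" "(g ^^ b) x = x" "(h ^^ b) y = h y"
    if "x \<in> X" "y \<in> Y" for x y
    using red[OF that, of a] red[OF that, of b] *[OF that] a b by (simp_all add: cong_def)
  then show "A \<in> ?L" "A \<in> ?R"
    using A'[of _ _ a] A'[of _ _ b] by (simp_all add: mem_invs_product_iff)
qed

text \<open>Each factor is embedded with trivial other component. The join found in the product need
  not have this form, but cylinders isolate the component that matters.\<close>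

lemma join_coherent_product_imp_factors:
  assumes ne: "X \<noteq> {}" "Y \<noteq> {}"
    and J: "join_coherent (perm_group X G \<times>\<times> perm_group Y H) (X \<times> Y) (product_action X Y)"
  shows "join_coherent (perm_group X G) X natural_action"
    and "join_coherent (perm_group Y H) Y natural_action"
proof -
  note J = J[unfolded join_coherent_product_iff[OF G.subgroup H.subgroup], rule_format]
  show "join_coherent (perm_group X G) X natural_action"
    unfolding join_coherent_natural_iff[OF G.subgroup]
  proof (intro ballI)
    fix g g' assume g: "g \<in> G" "g' \<in> G"
    obtain k l where k: "k \<in> G" "l \<in> H" "invs (X \<times> Y) (product_action X Y (k, l)) =
        invs (X \<times> Y) (product_action X Y (g, \<lambda>y\<in>Y. y)) \<inter>
        invs (X \<times> Y) (product_action X Y (g', \<lambda>y\<in>Y. y))"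
      using J[of "(g, \<lambda>y\<in>Y. y)" "(g', \<lambda>y\<in>Y. y)"] g H.perm_id by auto
    have "A \<in> invs X k \<longleftrightarrow> A \<in> invs X g \<inter> invs X g'" for A
      using k(3) cylinder_left_iff[OF ne(2) k(2), of A k] cylinder_left_iff[OF ne(2) H.perm_id, of A] by blast
    then show "\<exists>k\<in>G. invs X k = invs X g \<inter> invs X g'"
      using k(1) by blast
  qed
  show "join_coherent (perm_group Y H) Y natural_action"
    unfolding join_coherent_natural_iff[OF H.subgroup]
  proof (intro ballI)
    fix h h' assume h: "h \<in> H" "h' \<in> H"
    obtain k l where k: "k \<in> G" "l \<in> H" "invs (X \<times> Y) (product_action X Y (k, l)) =
        invs (X \<times> Y) (product_action X Y (\<lambda>x\<in>X. x, h)) \<inter>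
        invs (X \<times> Y) (product_action X Y (\<lambda>x\<in>X. x, h'))"
      using J[of "(\<lambda>x\<in>X. x, h)" "(\<lambda>x\<in>X. x, h')"] h G.perm_id by auto
    have "A \<in> invs Y l \<longleftrightarrow> A \<in> invs Y h \<inter> invs Y h'" for A
      using k(3) cylinder_right_iff[OF ne(1) k(1), of A l] cylinder_right_iff[OF ne(1) G.perm_id, of A] by blast
    then show "\<exists>k\<in>H. invs Y k = invs Y h \<inter> invs Y h'"
      using k(2) by blast
  qed
qed

lemma join_coherent_product_imp_coprime:
  assumes ne: "X \<noteq> {}" "Y \<noteq> {}" and fin: "finite G" "finite H"
    and J: "join_coherent (perm_group X G \<times>\<times> perm_group Y H) (X \<times> Y) (product_action X Y)"
  shows "coprime (order (perm_group X G)) (order (perm_group Y H))"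
proof (rule ccontr)
  interpret GH: right_action "perm_group X G \<times>\<times> perm_group Y H" "X \<times> Y" "product_action X Y"
    by (rule right_action_product[OF G.subgroup H.subgroup])
  assume "\<not> ?thesis"
  then have "gcd (order (perm_group X G)) (order (perm_group Y H)) \<noteq> 1"
    using coprime_iff_gcd_eq_1 by blast
  then obtain p where p: "prime p" "p dvd order (perm_group X G)" "p dvd order (perm_group Y H)"
    using prime_factor_nat by (metis gcd_nat.boundedE)
  obtain g x where g: "g \<in> G" "x \<in> X" "g x \<noteq> x" "(g ^^ p) x = x"
    using G.prime_order_moved_point[OF fin(1) p(1,2)] by metis
  obtain h y where h: "h \<in> H" "y \<in> Y" "h y \<noteq> y" "(h ^^ p) y = y"
    using H.prime_order_moved_point[OF fin(2) p(1,3)] by metis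
  let ?i = "\<lambda>x\<in>X. x" and ?j = "\<lambda>y\<in>Y. y"
  obtain k l where k: "k \<in> G" "l \<in> H" and kl: "invs (X \<times> Y) (product_action X Y (k, l)) =
      invs (X \<times> Y) (product_action X Y (g, ?j)) \<inter> invs (X \<times> Y) (product_action X Y (?i, h))"
    using J[unfolded join_coherent_product_iff[OF G.subgroup H.subgroup], rule_format,
        of "(g, ?j)" "(?i, h)"] g(1) h(1) G.perm_id H.perm_id by auto
  \<comment> \<open>Every cylinder over a subset of \<open>X\<close> is invariant under
    \<open>(?i, h)\<close>, so on cylinders only \<open>g\<close> imposes a condition.\<close>
  have "A \<in> invs X k \<longleftrightarrow> A \<in> invs X g" for A
    using kl cylinder_left_iff[OF ne(2) k(2), of A k] cylinder_left_iff[OF ne(2) H.perm_id, of A g]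
      cylinder_left_iff[OF ne(2) h(1), of A ?i] G.invs_id by blast
  then have kg: "invs X k = invs X g" by blast
  have "A \<in> invs Y l \<longleftrightarrow> A \<in> invs Y h" for A
    using kl cylinder_right_iff[OF ne(1) k(1), of A l] cylinder_right_iff[OF ne(1) G.perm_id, of A h]
      cylinder_right_iff[OF ne(1) g(1), of A ?j] H.invs_id by blast
  then have lh: "invs Y l = invs Y h" by blast
  \<comment> \<open>The join puts \<open>(x, h y)\<close> into the orbit of \<open>(x, y)\<close>.
    But a power of \<open>(k, l)\<close> that fixes \<open>x\<close> has exponent divisible by
    \<open>p\<close>, so it fixes \<open>y\<close> as well.\<close>
  let ?A = "forward_orbit (product_action X Y (k, l)) (x, y)"
  have "?A \<in> invs (X \<times> Y) (product_action X Y (k, l))"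
    using k g(2) h(2) fin by (intro GH.forward_orbit_invs) auto
  then have "?A \<in> invs (X \<times> Y) (product_action X Y (?i, h))"
    using kl by blast
  from this[unfolded mem_invs_product_iff, rule_format, OF g(2) h(2)]
  have "(?i x, h y) \<in> ?A"
    using self_in_forward_orbit by (rule iffD2)
  then obtain n where "(?i x, h y) = (product_action X Y (k, l) ^^ n) (x, y)"
    unfolding forward_orbit_def by (rule rangeE)
  then have "(x, h y) = ((k ^^ n) x, (l ^^ n) y)"
    using g(2) by (simp only: funpow_product_action[OF k g(2) h(2)] restrict_apply')
  then have n: "(k ^^ n) x = x" "(l ^^ n) y = h y"
    by (metis prod.inject)+
  have "p dvd n"
    using G.funpow_prime_fixed_iff_invs_eq[OF fin(1) g(1) k(1) g(2) kg p(1) g(4,3)] n(1) by simp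
  then have "(l ^^ n) y = y"
    using H.funpow_prime_fixed_iff_invs_eq[OF fin(2) h(1) k(2) h(2) lh p(1) h(4,3)] by simp
  then show False
    using n(2) h(3) by simp
qed

text \<open>By \<open>invs_product_coprime\<close>, invariance under a pair is a condition on the
  rows together with one on the columns, and the two are joined separately.\<close>

lemma join_coherent_productI:
  assumes fin: "finite G" "finite H"
    and JG: "join_coherent (perm_group X G) X natural_action"
    and JH: "join_coherent (perm_group Y H) Y natural_action"
    and cop: "coprime (order (perm_group X G)) (order (perm_group Y H))"
  shows "join_coherent (perm_group X G \<times>\<times> perm_group Y H) (X \<times> Y) (product_action X Y)"
  unfolding join_coherent_product_iff[OF G.subgroup H.subgroup]
proof (intro ballI)
  fix u v assume "u \<in> G \<times> H" "v \<in> G \<times> H"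
  then obtain g h g' h' where uv: "u = (g, h)" "v = (g', h')" "g \<in> G" "h \<in> H" "g' \<in> G" "h' \<in> H"
    by auto
  obtain k where k: "k \<in> G" "invs X k = invs X g \<inter> invs X g'"
    using JG uv unfolding join_coherent_natural_iff[OF G.subgroup] by blast
  obtain l where l: "l \<in> H" "invs Y l = invs Y h \<inter> invs Y h'"
    using JH uv unfolding join_coherent_natural_iff[OF H.subgroup] by blast
  note * = invs_product_coprime[OF fin cop]
  have "invs (X \<times> Y) (product_action X Y (k, l)) =
      invs (X \<times> Y) (product_action X Y u) \<inter> invs (X \<times> Y) (product_action X Y v)"
    unfolding uv(1,2) *[OF k(1) l(1)] *[OF uv(3,4)] *[OF uv(5,6)]
    by (auto simp: invs_product_left_iff invs_product_right_iff k(2) l(2))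
  then show "\<exists>w\<in>G \<times> H. invs (X \<times> Y) (product_action X Y w) =
      invs (X \<times> Y) (product_action X Y u) \<inter> invs (X \<times> Y) (product_action X Y v)"
    using k(1) l(1) by blast
qed

section \<open>The imprimitive action of the wreath product\<close>

text \<open>Cylinders over subsets of \<open>Y\<close> isolate the component in \<open>H\<close>.
  For \<open>G\<close>, an element is placed on the single fibre over a point
  \<open>c\<close>.\<close>

lemma join_coherent_imprimitive_imp_factors:
  assumes ne: "X \<noteq> {}" "Y \<noteq> {}"
    and J: "join_coherent (wreath_product (perm_group X G) Y (perm_group Y H)) (X \<times> Y)
      (imprimitive_action X Y)"
  shows "join_coherent (perm_group X G) X natural_action"
    and "join_coherent (perm_group Y H) Y natural_action"
proof -
  note J = J[unfolded join_coherent_imprimitive_iff[OF G.subgroup H.subgroup], rule_format]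
  let ?id = "\<lambda>x\<in>X. x" and ?F = "imprimitive_action X Y"
  show "join_coherent (perm_group Y H) Y natural_action"
    unfolding join_coherent_natural_iff[OF H.subgroup]
  proof (intro ballI)
    fix h h' assume h: "h \<in> H" "h' \<in> H"
    obtain f k where k: "f \<in> Y \<rightarrow>\<^sub>E G" "k \<in> H" "invs (X \<times> Y) (?F (f, k)) =
        invs (X \<times> Y) (?F (\<lambda>y\<in>Y. ?id, h)) \<inter> invs (X \<times> Y) (?F (\<lambda>y\<in>Y. ?id, h'))"
      using J[of "(\<lambda>y\<in>Y. ?id, h)" "(\<lambda>y\<in>Y. ?id, h')"] h G.perm_id by auto
    have "UNIV \<times> A \<in> invs (X \<times> Y) (?F (f, h)) \<longleftrightarrow> A \<in> invs Y h" for A f h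
      unfolding mem_invs_imprimitive_iff using ne(1) by (auto simp: invs_def)
    then have "A \<in> invs Y k \<longleftrightarrow> A \<in> invs Y h \<inter> invs Y h'" for A
      using k(3) by blast
    then show "\<exists>k\<in>H. invs Y k = invs Y h \<inter> invs Y h'"
      using k(2) by blast
  qed
  obtain c where c: "c \<in> Y"
    using ne(2) by blast
  define \<iota> where "\<iota> g = (\<lambda>y\<in>Y. if y = c then g else ?id)" for g
  have \<iota>: "\<iota> g \<in> Y \<rightarrow>\<^sub>E G" if "g \<in> G" for g
    using that G.perm_id by (auto simp: \<iota>_def)
  \<comment> \<open>As \<open>h\<close> is injective, no other fibre is sent to that over
    \<open>c\<close>, so the condition involves \<open>f c\<close> alone.\<close>
  have fibre: "A \<times> {c} \<in> invs (X \<times> Y) (?F (f, h)) \<longleftrightarrow> A \<in> invs X (f c)"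
    if "h \<in> H" "h c = c" for A f h
  proof -
    have "h y = c \<longleftrightarrow> y = c" if "y \<in> Y" for y
      using H.perm_bij[OF \<open>h \<in> H\<close>] that c \<open>h c = c\<close> by (metis bij_betw_imp_inj_on inj_on_eq_iff)
    then show ?thesis
      unfolding mem_invs_imprimitive_iff using c by (auto simp: invs_def)
  qed
  show "join_coherent (perm_group X G) X natural_action"
    unfolding join_coherent_natural_iff[OF G.subgroup]
  proof (intro ballI)
    fix g g' assume g: "g \<in> G" "g' \<in> G"
    let ?j = "\<lambda>y\<in>Y. y"
    obtain f k where k: "f \<in> Y \<rightarrow>\<^sub>E G" "k \<in> H" "invs (X \<times> Y) (?F (f, k)) =
        invs (X \<times> Y) (?F (\<iota> g, ?j)) \<inter> invs (X \<times> Y) (?F (\<iota> g', ?j))"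
      using J[of "(\<iota> g, ?j)" "(\<iota> g', ?j)"] g \<iota> H.perm_id by auto
    have "\<iota> g y x \<in> X" if "g \<in> G" "x \<in> X" "y \<in> Y" for g x y
      using G.perm_maps[OF PiE_mem[OF \<iota>]] that by blast
    \<comment> \<open>The whole fibre over \<open>c\<close> is preserved by both elements and hence
      by their join; this forces \<open>k\<close> to fix \<open>c\<close>.\<close>
    then have "X \<times> {c} \<in> invs (X \<times> Y) (?F (\<iota> g, ?j)) \<inter> invs (X \<times> Y) (?F (\<iota> g', ?j))"
      using g by (auto simp: mem_invs_imprimitive_iff)
    then have kc: "k c = c"
      using k(3) mem_invs_imprimitive_iff[of "X \<times> {c}" X Y f k] c ne(1) by blast
    have "A \<in> invs X (f c) \<longleftrightarrow> A \<in> invs X g \<inter> invs X g'" for A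
      using k(3) fibre[OF k(2) kc, of A f] fibre[OF H.perm_id, of A "\<iota> g"]
        fibre[OF H.perm_id, of A "\<iota> g'"] c by (auto simp: \<iota>_def)
    then show "\<exists>k\<in>G. invs X k = invs X g \<inter> invs X g'"
      using PiE_mem[OF k(1) c] by blast
  qed
qed

text \<open>The coordinates \<open>t y\<close> on the fibre over \<open>y\<close> turn the cocycle \<open>f\<close> into \<open>s\<close>.\<close>

lemma invs_imprimitive_transport:
  assumes t: "\<And>y. y \<in> Y \<Longrightarrow> t y \<in> G"
    and s: "\<And>x y. x \<in> X \<Longrightarrow> y \<in> Y \<Longrightarrow> t (h y) (s y x) = f y (t y x)"
  shows "A \<in> invs (X \<times> Y) (imprimitive_action X Y (f, h)) \<longleftrightarrow>
    (\<forall>x\<in>X. \<forall>y\<in>Y. (t (h y) (s y x), h y) \<in> A \<longleftrightarrow> (t y x, y) \<in> A)"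
proof
  assume "A \<in> invs (X \<times> Y) (imprimitive_action X Y (f, h))"
  then show "\<forall>x\<in>X. \<forall>y\<in>Y. (t (h y) (s y x), h y) \<in> A \<longleftrightarrow> (t y x, y) \<in> A"
    unfolding mem_invs_imprimitive_iff using s G.perm_maps[OF t] by simp
next
  assume *: "\<forall>x\<in>X. \<forall>y\<in>Y. (t (h y) (s y x), h y) \<in> A \<longleftrightarrow> (t y x, y) \<in> A"
  show "A \<in> invs (X \<times> Y) (imprimitive_action X Y (f, h))"
    unfolding mem_invs_imprimitive_iff
  proof (intro ballI)
    fix x y assume "x \<in> X" "y \<in> Y"
    then obtain x' where "x' \<in> X" "x = t y x'"
      using G.perm_bij[OF t] by (metis bij_betw_imp_surj_on imageE)
    then show "(f y x, h y) \<in> A \<longleftrightarrow> (x, y) \<in> A"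
      using * s \<open>y \<in> Y\<close> by metis
  qed
qed

text \<open>Finiteness of \<open>Y\<close> enters twice: it makes \<open>H\<close> finite, so that
  forward orbits are orbits, and it leaves only finitely many elements of \<open>G\<close> to be
  joined.\<close>

lemma join_coherent_imprimitiveI:
  assumes fin: "finite Y"
    and JG: "join_coherent (perm_group X G) X natural_action"
    and JH: "join_coherent (perm_group Y H) Y natural_action"
  shows "join_coherent (wreath_product (perm_group X G) Y (perm_group Y H)) (X \<times> Y)
    (imprimitive_action X Y)"
  unfolding join_coherent_imprimitive_iff[OF G.subgroup H.subgroup]
proof (intro ballI)
  fix u v assume uv: "u \<in> (Y \<rightarrow>\<^sub>E G) \<times> H" "v \<in> (Y \<rightarrow>\<^sub>E G) \<times> H"
  let ?F = "imprimitive_action X Y"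
  define S where "S = {u, v}"
  define I where "I = {A. \<forall>w\<in>S. A \<in> invs (X \<times> Y) (?F w)}"
  have S: "f \<in> Y \<rightarrow>\<^sub>E G" "h \<in> H" "\<And>y. y \<in> Y \<Longrightarrow> f y \<in> G" if "(f, h) \<in> S" for f h
    using uv that by (auto simp: S_def)
  have I: "(f y x, h y) \<in> A \<longleftrightarrow> (x, y) \<in> A"
    if "A \<in> I" "(f, h) \<in> S" "x \<in> X" "y \<in> Y" for A f h x y
    using that by (auto simp: I_def mem_invs_imprimitive_iff)
  obtain k where k: "k \<in> H" "invs Y k = invs Y (snd u) \<inter> invs Y (snd v)"
    using JH uv unfolding join_coherent_natural_iff[OF H.subgroup] by (metis mem_Times_iff)
  have invs_k: "A \<in> invs Y k \<longleftrightarrow> (\<forall>f h. (f, h) \<in> S \<longrightarrow> A \<in> invs Y h)" for A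
    unfolding k(2) S_def by (cases u; cases v) auto
  have ky: "k y \<in> Y" if "y \<in> Y" for y
    by (rule H.perm_maps[OF k(1) that])

  have "H \<subseteq> Y \<rightarrow>\<^sub>E Y"
    by (intro subsetI) (simp add: PiE_iff H.perm_maps H.perm_ext)
  then have finH: "finite H"
    by (rule finite_subset) (simp add: finite_PiE fin)
  let ?o = "forward_orbit k"
  have orb: "?o y \<in> invs Y k" "?o y \<subseteq> Y" if "y \<in> Y" for y
  proof -
    show "?o y \<in> invs Y k"
      by (rule H.forward_orbit_invs_perm[OF finH k(1) that])
    show "?o y \<subseteq> Y"
      using that ky by (intro H.forward_orbit_subset_perm[OF k(1)] invsI) auto
  qed
  have orb_eq: "?o (k y) = ?o y" if y: "y \<in> Y" for y
  proof
    show "?o (k y) \<subseteq> ?o y"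
      using invsD[OF orb(1)[OF y] y] self_in_forward_orbit[of y k]
      by (intro H.forward_orbit_subset_perm[OF k(1) ky[OF y] orb(1)[OF y]]) simp
    show "?o y \<subseteq> ?o (k y)"
      using invsD[OF orb(1)[OF ky[OF y]] y] self_in_forward_orbit[of "k y" k]
      by (intro H.forward_orbit_subset_perm[OF k(1) y orb(1)[OF ky[OF y]]]) simp
  qed
  \<comment> \<open>The choice depends only on the orbit as a set, so all points of an orbit get the
    same representative.\<close>
  define r where "r y = (SOME z. z \<in> ?o y)" for y
  have r_in: "r y \<in> ?o y" for y
    unfolding r_def using self_in_forward_orbit[of y k] by (rule someI)
  have rY: "r y \<in> Y" if "y \<in> Y" for y
    using r_in orb(2)[OF that] by blast
  \<comment> \<open>A class of \<open>r\<close> is invariant under \<open>k\<close>, hence under the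
    \<open>H\<close>-components of both given elements.\<close>
  have r_inv: "{z. r z = c} \<in> invs Y k" for c
    by (rule invsI) (simp add: r_def orb_eq)
  have rk: "r (k y) = r y" if "y \<in> Y" for y
    by (simp add: r_def orb_eq that)
  have rh: "r (h y) = r y" if "(f, h) \<in> S" "y \<in> Y" for f h y
    using r_inv[of "r y"] that unfolding invs_k by (auto dest: invsD)
  have rr: "r (r y) = r y" if y: "y \<in> Y" for y
    using H.forward_orbit_subset_perm[OF k(1) y r_inv[of "r y"]] r_in[of y] by auto
  \<comment> \<open>Otherwise the complement of \<open>?o (r y)\<close> is invariant and contains
    \<open>y\<close>, hence the orbit of \<open>y\<close> and with it \<open>r y\<close>.\<close>
  have in_orb: "y \<in> ?o (r y)" if y: "y \<in> Y" for y
  proof (rule ccontr)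
    assume "y \<notin> ?o (r y)"
    moreover have "- ?o (r y) \<in> invs Y k"
      using orb(1)[OF rY[OF y]] by (simp add: invs_def)
    ultimately have "?o y \<subseteq> - ?o (r y)"
      by (intro H.forward_orbit_subset_perm[OF k(1) y]) simp_all
    then show False
      using r_in[of y] self_in_forward_orbit[of "r y" k] by blast
  qed

  have "\<exists>t\<in>G. \<forall>A\<in>I. \<forall>x\<in>X. (t x, y) \<in> A \<longleftrightarrow> (x, r y) \<in> A" if y: "y \<in> Y" for y
  proof -
    \<comment> \<open>\<open>T\<close> collects the points whose fibre is matched with that over
      \<open>r y\<close> by one element of \<open>G\<close>, for all jointly invariant sets at once.
      It is \<open>k\<close>-invariant and contains \<open>r y\<close>, hence
      \<open>y\<close>.\<close>
    define T where "T = {z. \<exists>t\<in>G. \<forall>A\<in>I. \<forall>x\<in>X. (t x, z) \<in> A \<longleftrightarrow> (x, r y) \<in> A}"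
    have "h z \<in> T \<longleftrightarrow> z \<in> T" if fh: "(f, h) \<in> S" and z: "z \<in> Y" for f h z
    proof
      note fz = S(3)[OF fh z]
      assume "z \<in> T"
      then obtain t where t: "t \<in> G" "\<forall>A\<in>I. \<forall>x\<in>X. (t x, z) \<in> A \<longleftrightarrow> (x, r y) \<in> A"
        by (auto simp: T_def)
      have "(compose X (f z) t x, h z) \<in> A \<longleftrightarrow> (x, r y) \<in> A" if "A \<in> I" "x \<in> X" for A x
        using I[OF that(1) fh G.perm_maps[OF t(1) that(2)] z] t(2) that by (simp add: compose_def)
      then show "h z \<in> T"
        unfolding T_def using G.perm_compose[OF fz t(1)] by blast
    next
      note fz = S(3)[OF fh z]
      assume "h z \<in> T"
      then obtain t where t: "t \<in> G" "\<forall>A\<in>I. \<forall>x\<in>X. (t x, h z) \<in> A \<longleftrightarrow> (x, r y) \<in> A"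
        by (auto simp: T_def)
      obtain f' where f': "f' \<in> G" "\<And>x. x \<in> X \<Longrightarrow> f z (f' x) = x"
        using G.perm_inverse[OF fz] by metis
      have "(compose X f' t x, z) \<in> A \<longleftrightarrow> (x, r y) \<in> A" if "A \<in> I" "x \<in> X" for A x
        using I[OF that(1) fh G.perm_maps[OF f'(1) G.perm_maps[OF t(1) that(2)]] z]
          f'(2)[OF G.perm_maps[OF t(1) that(2)]] t(2) that by (simp add: compose_def)
      then show "z \<in> T"
        unfolding T_def using G.perm_compose[OF f'(1) t(1)] by blast
    qed
    then have "T \<in> invs Y k"
      unfolding invs_k by (auto intro: invsI)
    moreover have "r y \<in> T"
      unfolding T_def using G.perm_id by (auto intro!: bexI[of _ "\<lambda>x\<in>X. x"])
    ultimately have "?o (r y) \<subseteq> T"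
      by (rule H.forward_orbit_subset_perm[OF k(1) rY[OF y]])
    then show ?thesis
      using in_orb[OF y] by (auto simp: T_def)
  qed
  then obtain t where t: "\<And>y. y \<in> Y \<Longrightarrow> t y \<in> G"
    "\<And>y A x. y \<in> Y \<Longrightarrow> A \<in> I \<Longrightarrow> x \<in> X \<Longrightarrow> (t y x, y) \<in> A \<longleftrightarrow> (x, r y) \<in> A"
    by metis
  have "\<exists>t'. t' \<in> G \<and> (\<forall>x\<in>X. t' (t y x) = x \<and> t y (t' x) = x)" if "y \<in> Y" for y
    using G.perm_inverse[OF t(1)[OF that]] by metis
  then obtain t' where t': "\<And>y. y \<in> Y \<Longrightarrow> t' y \<in> G"
    "\<And>y x. y \<in> Y \<Longrightarrow> x \<in> X \<Longrightarrow> t' y (t y x) = x"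
    "\<And>y x. y \<in> Y \<Longrightarrow> x \<in> X \<Longrightarrow> t y (t' y x) = x"
    by metis
  \<comment> \<open>In the coordinates \<open>t\<close>, this is how \<open>w\<close> maps the fibre
    over \<open>y\<close> to the next one.\<close>
  define \<sigma> where "\<sigma> w y = compose X (t' (snd w y)) (compose X (fst w y) (t y))"
    for w :: "('b \<Rightarrow> 'a \<Rightarrow> 'a) \<times> ('b \<Rightarrow> 'b)" and y
  have hY: "h y \<in> Y" if "(f, h) \<in> S" "y \<in> Y" for f h y
    using H.perm_maps[OF S(2)] that by blast
  have \<sigma>G: "\<sigma> (f, h) y \<in> G" if "(f, h) \<in> S" "y \<in> Y" for f h y
    unfolding \<sigma>_def using that by (simp add: G.perm_compose t t' hY S)
  have \<sigma>: "t (h y) (\<sigma> (f, h) y x) = f y (t y x)" if "(f, h) \<in> S" "y \<in> Y" "x \<in> X" for f h y x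
    unfolding \<sigma>_def using that
    by (simp add: compose_def t'(3) hY G.perm_maps[OF S(3)] G.perm_maps[OF t(1)])
  have "\<exists>s\<in>G. invs X s = {A. \<forall>g\<in>{\<sigma> w y | w y. w \<in> S \<and> y \<in> Y \<and> r y = c}. A \<in> invs X g}" for c
  proof (rule G.join_finite)
    show "\<forall>g\<in>G. \<forall>h\<in>G. \<exists>k\<in>G. invs X k = invs X g \<inter> invs X h"
      using JG unfolding join_coherent_natural_iff[OF G.subgroup] .
    show "{\<sigma> w y | w y. w \<in> S \<and> y \<in> Y \<and> r y = c} \<subseteq> G"
      using \<sigma>G by auto
    have "{\<sigma> w y | w y. w \<in> S \<and> y \<in> Y \<and> r y = c} \<subseteq> (\<lambda>(w, y). \<sigma> w y) ` (S \<times> Y)"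
      by auto
    then show "finite {\<sigma> w y | w y. w \<in> S \<and> y \<in> Y \<and> r y = c}"
      by (rule finite_subset) (simp add: fin S_def)
  qed
  then obtain s where s: "\<And>c. s c \<in> G" "\<And>c. invs X (s c) =
      {A. \<forall>g\<in>{\<sigma> w y | w y. w \<in> S \<and> y \<in> Y \<and> r y = c}. A \<in> invs X g}"
    by metis
  \<comment> \<open>On each cycle of \<open>k\<close>, only the step returning to the representative
    may carry a nontrivial factor. At a fixed point of \<open>k\<close> that step is the whole
    cycle.\<close>
  define e where "e y = (if k y = r y then s (r y) else (\<lambda>x\<in>X. x))" for y
  define f where "f = (\<lambda>y\<in>Y. compose X (t (k y)) (compose X (e y) (t' y)))"
  have eG: "e y \<in> G" for y
    using s(1) G.perm_id by (simp add: e_def)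
  have fG: "f \<in> Y \<rightarrow>\<^sub>E G"
    using eG t(1) t'(1) ky by (auto simp: f_def intro!: G.perm_compose)
  have fe: "t (k y) (e y x) = f y (t y x)" if "x \<in> X" "y \<in> Y" for x y
    using that G.perm_maps[OF t(1)] by (simp add: f_def compose_def t'(2))

  have "A \<in> invs (X \<times> Y) (?F (f, k)) \<longleftrightarrow> A \<in> I" for A
  proof -
    \<comment> \<open>\<open>B y\<close> is the fibre of \<open>A\<close> over \<open>y\<close> in
      the coordinates \<open>t\<close>.\<close>
    define B where "B y = {x. (t y x, y) \<in> A}" for y
    have fk_iff: "A \<in> invs (X \<times> Y) (?F (f, k)) \<longleftrightarrow>
        (\<forall>x\<in>X. \<forall>y\<in>Y. e y x \<in> B (k y) \<longleftrightarrow> x \<in> B y)"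
      using invs_imprimitive_transport[where t = t and s = e and f = f and h = k, OF t(1) fe]
      by (simp add: B_def)
    have "A \<in> invs (X \<times> Y) (?F (f, h)) \<longleftrightarrow>
        (\<forall>x\<in>X. \<forall>y\<in>Y. \<sigma> (f, h) y x \<in> B (h y) \<longleftrightarrow> x \<in> B y)" if "(f, h) \<in> S" for f h
      using invs_imprimitive_transport[where t = t and s = "\<sigma> (f, h)" and f = f and h = h, OF t(1) \<sigma>[OF that]]
      by (simp add: B_def)
    then have I_iff: "A \<in> I \<longleftrightarrow>
        (\<forall>f h. (f, h) \<in> S \<longrightarrow> (\<forall>x\<in>X. \<forall>y\<in>Y. \<sigma> (f, h) y x \<in> B (h y) \<longleftrightarrow> x \<in> B y))"
      unfolding I_def by (simp add: split_paired_Ball_Sigma Ball_def split_paired_All)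
    have s_iff: "D \<in> invs X (s c) \<longleftrightarrow>
        (\<forall>w y. w \<in> S \<and> y \<in> Y \<and> r y = c \<longrightarrow> D \<in> invs X (\<sigma> w y))" for D c
      unfolding s(2) by blast
    show ?thesis
    proof
      assume A: "A \<in> I"
      have B: "x \<in> B y \<longleftrightarrow> (x, r y) \<in> A" if "x \<in> X" "y \<in> Y" for x y
        using t(2)[OF that(2) A that(1)] by (simp add: B_def)
      \<comment> \<open>On \<open>X\<close>, all \<open>B y\<close> with \<open>r y = c\<close>
        agree with the fibre of \<open>A\<close> over \<open>c\<close>, so joint invariance says
        that this one set is invariant under every \<open>\<sigma> w y\<close>.\<close>
      have "{x. (x, c) \<in> A} \<in> invs X (s c)" for c
        unfolding s_iff
      proof (intro allI impI invsI)
        fix w y x assume "w \<in> S \<and> y \<in> Y \<and> r y = c" "x \<in> X"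
        then obtain f h where w: "w = (f, h)" and *: "(f, h) \<in> S" "y \<in> Y" "r y = c" "x \<in> X"
          by (cases w) auto
        have "\<sigma> (f, h) y x \<in> B (h y) \<longleftrightarrow> x \<in> B y"
          using A * unfolding I_iff by blast
        then show "\<sigma> w y x \<in> {x. (x, c) \<in> A} \<longleftrightarrow> x \<in> {x. (x, c) \<in> A}"
          using B[OF *(4,2)] B[OF G.perm_maps[OF \<sigma>G[OF *(1,2)] *(4)] hY[OF *(1,2)]] rh[OF *(1,2)] *(3)
          by (simp add: w)
      qed
      then have "(e y x, r y) \<in> A \<longleftrightarrow> (x, r y) \<in> A" if "x \<in> X" for x y
        using that by (auto simp: e_def dest: invsD)
      then show "A \<in> invs (X \<times> Y) (?F (f, k))"
        unfolding fk_iff using B ky rk G.perm_maps[OF eG] by simp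
    next
      assume "A \<in> invs (X \<times> Y) (?F (f, k))"
      then have e: "e y x \<in> B (k y) \<longleftrightarrow> x \<in> B y" if "x \<in> X" "y \<in> Y" for x y
        using that unfolding fk_iff by blast
      \<comment> \<open>Walking from \<open>r y\<close> along \<open>k\<close>, a step that does not
        arrive at \<open>r y\<close> has trivial factor and leaves \<open>B\<close> unchanged; on
        arrival at \<open>r y\<close> there is nothing to show.\<close>
      have const: "x \<in> B y \<longleftrightarrow> x \<in> B (r y)" if x: "x \<in> X" and y: "y \<in> Y" for x y
      proof -
        have "(k ^^ n) (r y) \<in> Y \<and> (x \<in> B ((k ^^ n) (r y)) \<longleftrightarrow> x \<in> B (r y)) \<and> r ((k ^^ n) (r y)) = r y" for n
        proof (induction n)
          case 0
          show ?case
            using rY[OF y] rr[OF y] by simp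
        next
          case (Suc n)
          let ?z = "(k ^^ n) (r y)"
          have "x \<in> B (k ?z) \<longleftrightarrow> x \<in> B (r y)"
          proof (cases "k ?z = r y")
            case False
            then have "e ?z x = x"
              using Suc x by (simp add: e_def)
            then show ?thesis
              using e[OF x, of ?z] Suc by simp
          qed simp
          then show ?case
            using Suc ky rk by simp
        qed
        moreover obtain n where "(k ^^ n) (r y) = y"
          using in_orb[OF y] unfolding forward_orbit_def by (metis imageE)
        ultimately show ?thesis
          by metis
      qed
      have B: "B (r z) \<in> invs X (s (r z))" if z: "z \<in> Y" for z
      proof (rule invsI)
        fix x assume x: "x \<in> X"
        \<comment> \<open>The predecessor of the representative carries the factor
          \<open>s (r z)\<close>; \<open>const\<close> moves the condition from \<open>y\<close> to
          the representative.\<close>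
        obtain y where y: "y \<in> Y" "k y = r z"
          using H.perm_bij[OF k(1)] rY[OF z] by (metis bij_betw_imp_surj_on imageE)
        then have ry: "r y = r z"
          using rk[of y] rr[OF z] by simp
        then have "e y = s (r z)"
          using y by (simp add: e_def)
        then show "s (r z) x \<in> B (r z) \<longleftrightarrow> x \<in> B (r z)"
          using e[OF x y(1)] const[OF x y(1)] y(2) ry by simp
      qed
      show "A \<in> I"
        unfolding I_iff
      proof (intro allI impI ballI)
        fix f h x y assume *: "(f, h) \<in> S" "x \<in> X" "y \<in> Y"
        have "B (r y) \<in> invs X (\<sigma> (f, h) y)"
          using B[OF *(3)] *(1,3) unfolding s_iff by blast
        then have "\<sigma> (f, h) y x \<in> B (r y) \<longleftrightarrow> x \<in> B (r y)"
          using *(2) by (rule invsD)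
        then show "\<sigma> (f, h) y x \<in> B (h y) \<longleftrightarrow> x \<in> B y"
          using const[OF G.perm_maps[OF \<sigma>G[OF *(1,3)] *(2)] hY[OF *(1,3)]] const[OF *(2,3)]
            rh[OF *(1,3)] by simp
      qed
    qed
  qed
  then have "invs (X \<times> Y) (?F (f, k)) = invs (X \<times> Y) (?F u) \<inter> invs (X \<times> Y) (?F v)"
    by (auto simp: I_def S_def)
  then show "\<exists>w\<in>(Y \<rightarrow>\<^sub>E G) \<times> H. invs (X \<times> Y) (?F w) = invs (X \<times> Y) (?F u) \<inter> invs (X \<times> Y) (?F v)"
    using fG k(1) by blast
qed

end

text \<open>Both sets are nonempty: on an empty product every action is join-coherent, which says
  nothing about the factors.\<close>

theorem theorem2:
  fixes X :: "'a set" and Y :: "'b set"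
    and G :: "('a \<Rightarrow> 'a) set" and H :: "('b \<Rightarrow> 'b) set"
  assumes "X \<noteq> {}" and "Y \<noteq> {}"
    and "subgroup G (Sym X)" and "subgroup H (Sym Y)"
  shows "(finite G \<and> finite H \<longrightarrow>
           (join_coherent (perm_group X G \<times>\<times> perm_group Y H) (X \<times> Y) (product_action X Y) \<longleftrightarrow>
              join_coherent (perm_group X G) X natural_action \<and>
              join_coherent (perm_group Y H) Y natural_action \<and>
              coprime (order (perm_group X G)) (order (perm_group Y H))))
       \<and> (finite Y \<longrightarrow>
           (join_coherent (wreath_product (perm_group X G) Y (perm_group Y H)) (X \<times> Y)
                (imprimitive_action X Y) \<longleftrightarrow>
              join_coherent (perm_group X G) X natural_action \<and>
              join_coherent (perm_group Y H) Y natural_action))"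
proof -
  interpret two_permutation_groups X G Y H
    using assms(3,4) by (simp add: two_permutation_groups_def permutation_group_def)
  show ?thesis
  proof (intro conjI impI iffI)
    assume fin: "finite G \<and> finite H"
    assume J: "join_coherent (perm_group X G \<times>\<times> perm_group Y H) (X \<times> Y) (product_action X Y)"
    show "join_coherent (perm_group X G) X natural_action"
      and "join_coherent (perm_group Y H) Y natural_action"
      by (rule join_coherent_product_imp_factors[OF assms(1,2) J])+
    show "coprime (order (perm_group X G)) (order (perm_group Y H))"
      using join_coherent_product_imp_coprime[OF assms(1,2) _ _ J] fin by simp
  next
    assume "join_coherent (wreath_product (perm_group X G) Y (perm_group Y H)) (X \<times> Y)
      (imprimitive_action X Y)"
    note * = join_coherent_imprimitive_imp_factors[OF assms(1,2) this]
    show "join_coherent (perm_group X G) X natural_action"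
      by (rule *)
    show "join_coherent (perm_group Y H) Y natural_action"
      by (rule *)
  qed (use join_coherent_productI join_coherent_imprimitiveI in simp_all)
qed

end
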